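(* Let $(\mathcal C,\otimes,\mathbf I)$ be a strict monoidal category. Let $(V_i,\mu_i,\nu_i)_{1\le i\le r}$ be unital associative algebras in $\mathcal C$, and let $\xi_{i,j}\colon V_i\otimes V_j\to V_j\otimes V_i$, $1\le i<j\le r$, be morphisms natural with respect to the units $\nu_i$ and $\nu_j$. Suppose that each unit $\nu_i$ is part of a normalized pair $(\nu_i,\epsilon_i)$. Then the following statements are equivalent: (A) The morphisms $\xi_{i,i}:=\sigma_{Ass}(V_i)=\nu_i\otimes\mu_i$, $1\le i\le r$, complete the $\xi_{i,j}$ ($i<j$) and the $\nu_i$ into a pointed braided system structure on $(V_1,\dots,V_r)$. (B) Each $\xi_{i,j}$ ($i<j$) is natural with respect to $\mu_i$ and $\mu_j$, and, for each triple $i<j<k$, the $\xi$'s satisfy the colored Yang--Baxter equation on $V_i\otimes V_j\otimes V_k$. (C) A unital associative algebra structure on $\overleftarrow V:=V_r\otimes V_{r-1}\otimes\cdots\otimes V_1$ can be defined by putting $$\mu_{\overleftarrow V}=(\mu_r\otimes\cdots\otimes\mu_1)\,\xi_{1,2}^{2r-2}\,(\xi_{2,3}^{2r-4}\,\xi_{1,3}^{2r-3})\cdots(\xi_{r-1,r}^{2}\cdots\xi_{2,r}^{r-1}\,\xi_{1,r}^{r}),$$ $$\nu_{\overleftarrow V}=\nu_r\otimes\nu_{r-1}\otimes\cdots\otimes\nu_1.$$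
   Context: Juxtaposition of morphisms is composition (rightmost applied first). $\mathrm{Id}_i=\mathrm{Id}_{V_i}$. For a morphism $\varphi$, the notation $\varphi^p$ means $\varphi$ applied to consecutive tensor factors starting at position $p$, tensored with identities on the other factors; in particular $\xi_{i,j}^p$ is $\xi_{i,j}$ applied at positions $p,p+1$. Braided system: a rank $r$ braided system in $\mathcal C$ is an ordered family $V_1,\dots,V_r$ of objects with morphisms $\sigma_{i,j}\colon V_i\otimes V_j\to V_j\otimes V_i$ for $1\le i\le j\le r$ (not necessarily invertible) satisfying, on all $V_i\otimes V_j\otimes V_k$ with $i\le j\le k$, the colored Yang--Baxter equation $$(\sigma_{j,k}\otimes \mathrm{Id}_i)(\mathrm{Id}_j\otimes\sigma_{i,k})(\sigma_{i,j}\otimes\mathrm{Id}_k)=(\mathrm{Id}_k\otimes\sigma_{i,j})(\sigma_{i,k}\otimes\mathrm{Id}_j)(\mathrm{Id}_i\otimes\sigma_{j,k}).$$ A pointed braided system is a braided system together with distinguished morphisms $\nu_i\colon\mathbf I\to V_i$ (called units). A pair $(\eta\colon\mathbf I\to V,\ \epsilon\colon V\to\mathbf I)$ is normalized if $\epsilon\eta=\mathrm{Id}_{\mathbf I}$. Naturality: $\xi\colon V\otimes W\to W\otimes V$ is natural with respect to $\varphi\colon V^{\otimes n}\to V^{\otimes m}$ if $\xi^1\cdots\xi^m(\varphi\otimes\mathrm{Id}_W)=(\mathrm{Id}_W\otimes\varphi)\xi^1\cdots\xi^n$, and natural with respect to $\psi\colon W^{\otimes n}\to W^{\otimes m}$ if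 $\xi^m\cdots\xi^1(\mathrm{Id}_V\otimes\psi)=(\psi\otimes\mathrm{Id}_V)\xi^n\cdots\xi^1$. For $\xi_{i,j}$, naturality w.r.t. $\nu_i,\mu_i$ (resp. $\nu_j,\mu_j$) refers to the first (resp. second) condition. *)

theory Defs
  imports Main
begin

section \<open>Strict monoidal categories\<close>

text \<open>Categories are given by carriers of objects and morphisms, as in the record-and-locale style
  of HOL-Algebra. All operations are unconstrained outside these carriers, and \<open>Comp\<close> is
  constrained only on composable pairs.\<close>

record ('o, 'm) smc =
  Obj :: "'o set"
  Mor :: "'m set"
  Dom :: "'m \<Rightarrow> 'o"
  Cod :: "'m \<Rightarrow> 'o"
  Idt :: "'o \<Rightarrow> 'm" ("Id\<index>")
  Comp :: "'m \<Rightarrow> 'm \<Rightarrow> 'm" (infixr "\<cdot>\<index>" 65)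
  Unit :: "'o" ("\<I>\<index>")
  OTens :: "'o \<Rightarrow> 'o \<Rightarrow> 'o" (infixr "\<odot>\<index>" 70)
  MTens :: "'m \<Rightarrow> 'm \<Rightarrow> 'm" (infixr "\<otimes>\<index>" 70)

definition Hom :: "('o, 'm, 'z) smc_scheme \<Rightarrow> 'o \<Rightarrow> 'o \<Rightarrow> 'm set" where
  "Hom C a b = {f \<in> Mor C. Dom C f = a \<and> Cod C f = b}"

locale strict_monoidal_category =
  fixes C :: "('o, 'm, 'z) smc_scheme" (structure)
  assumes dom_closed: "f \<in> Mor C \<Longrightarrow> Dom C f \<in> Obj C"
    and cod_closed: "f \<in> Mor C \<Longrightarrow> Cod C f \<in> Obj C"
    and id_hom: "a \<in> Obj C \<Longrightarrow> Id a \<in> Hom C a a"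
    and comp_hom: "f \<in> Hom C a b \<Longrightarrow> g \<in> Hom C b c \<Longrightarrow> g \<cdot> f \<in> Hom C a c"
    and comp_id_right: "f \<in> Hom C a b \<Longrightarrow> f \<cdot> Id a = f"
    and comp_id_left: "f \<in> Hom C a b \<Longrightarrow> Id b \<cdot> f = f"
    and comp_assoc: "f \<in> Hom C a b \<Longrightarrow> g \<in> Hom C b c \<Longrightarrow> h \<in> Hom C c d
      \<Longrightarrow> (h \<cdot> g) \<cdot> f = h \<cdot> (g \<cdot> f)"
    and unit_obj: "\<I> \<in> Obj C"
    and otens_obj: "a \<in> Obj C \<Longrightarrow> b \<in> Obj C \<Longrightarrow> a \<odot> b \<in> Obj C"
    and otens_assoc: "a \<in> Obj C \<Longrightarrow> b \<in> Obj C \<Longrightarrow> c \<in> Obj C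
      \<Longrightarrow> (a \<odot> b) \<odot> c = a \<odot> (b \<odot> c)"
    and otens_unit_left: "a \<in> Obj C \<Longrightarrow> \<I> \<odot> a = a"
    and otens_unit_right: "a \<in> Obj C \<Longrightarrow> a \<odot> \<I> = a"
    and mtens_hom: "f \<in> Hom C a b \<Longrightarrow> g \<in> Hom C c d \<Longrightarrow> f \<otimes> g \<in> Hom C (a \<odot> c) (b \<odot> d)"
    and mtens_id: "a \<in> Obj C \<Longrightarrow> b \<in> Obj C \<Longrightarrow> Id a \<otimes> Id b = Id (a \<odot> b)"
    and mtens_comp: "f \<in> Hom C a b \<Longrightarrow> g \<in> Hom C b c \<Longrightarrow> f' \<in> Hom C a' b' \<Longrightarrow> g' \<in> Hom C b' c'
      \<Longrightarrow> (g \<cdot> f) \<otimes> (g' \<cdot> f') = (g \<otimes> g') \<cdot> (f \<otimes> f')"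
    and mtens_assoc: "f \<in> Mor C \<Longrightarrow> g \<in> Mor C \<Longrightarrow> h \<in> Mor C
      \<Longrightarrow> (f \<otimes> g) \<otimes> h = f \<otimes> (g \<otimes> h)"
    and mtens_unit_left: "f \<in> Mor C \<Longrightarrow> Id \<I> \<otimes> f = f"
    and mtens_unit_right: "f \<in> Mor C \<Longrightarrow> f \<otimes> Id \<I> = f"


section \<open>Morphisms acting on tensor words\<close>

definition otens_list :: "('o, 'm, 'z) smc_scheme \<Rightarrow> 'o list \<Rightarrow> 'o" where
  "otens_list C ws = foldr (OTens C) ws (Unit C)"

definition mtens_list :: "('o, 'm, 'z) smc_scheme \<Rightarrow> 'm list \<Rightarrow> 'm" where
  "mtens_list C fs = foldr (MTens C) fs (Idt C (Unit C))"

text \<open>\<open>act_at C \<phi> n p ws\<close> is the morphism written \<open>\<phi>\<^sup>p\<close>: \<open>\<phi>\<close> acts on the \<open>n\<close> consecutive factors of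
  the word \<open>ws\<close> starting at position \<open>p\<close>, and identities act on the other factors.
  Positions are counted from 1.\<close>

definition act_at :: "('o, 'm, 'z) smc_scheme \<Rightarrow> 'm \<Rightarrow> nat \<Rightarrow> nat \<Rightarrow> 'o list \<Rightarrow> 'm" where
  "act_at C \<phi> n p ws =
     Idt C (otens_list C (take (p - 1) ws))
       \<otimes>\<^bsub>C\<^esub> \<phi> \<otimes>\<^bsub>C\<^esub> Idt C (otens_list C (drop (p - 1 + n) ws))"

definition swap_at :: "nat \<Rightarrow> 'a list \<Rightarrow> 'a list" where
  "swap_at p ws = take (p - 1) ws @ [ws ! p, ws ! (p - 1)] @ drop (p + 1) ws"

text \<open>\<open>braid_comp C [(\<xi>\<^sub>1, p\<^sub>1), \<dots>, (\<xi>\<^sub>k, p\<^sub>k)] ws\<close> is the composite \<open>\<xi>\<^sub>1\<^sup>p\<^sup>1 \<cdots> \<xi>\<^sub>k\<^sup>p\<^sup>k\<close> with source the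
  tensor product of \<open>ws\<close>. As usual, the rightmost factor is applied first. Each \<open>\<xi>\<close> is meant to be
  of the form \<open>V \<otimes> W \<rightarrow> W \<otimes> V\<close>, so that each step interchanges two neighbouring letters.\<close>

primrec braid_comp :: "('o, 'm, 'z) smc_scheme \<Rightarrow> ('m \<times> nat) list \<Rightarrow> 'o list \<Rightarrow> 'm" where
  "braid_comp C [] ws = Idt C (otens_list C ws)"
| "braid_comp C (x # xs) ws =
     act_at C (fst x) 2 (snd x) (foldr (\<lambda>y. swap_at (snd y)) xs ws) \<cdot>\<^bsub>C\<^esub> braid_comp C xs ws"


section \<open>Algebras, naturality and braided systems\<close>

definition unital_assoc_algebra ::
  "('o, 'm, 'z) smc_scheme \<Rightarrow> 'o \<Rightarrow> 'm \<Rightarrow> 'm \<Rightarrow> bool" where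
  "unital_assoc_algebra C V \<mu> \<nu> \<longleftrightarrow>
     V \<in> Obj C \<and> \<mu> \<in> Hom C (V \<odot>\<^bsub>C\<^esub> V) V \<and> \<nu> \<in> Hom C (Unit C) V \<and>
     \<mu> \<cdot>\<^bsub>C\<^esub> (\<mu> \<otimes>\<^bsub>C\<^esub> Idt C V) = \<mu> \<cdot>\<^bsub>C\<^esub> (Idt C V \<otimes>\<^bsub>C\<^esub> \<mu>) \<and>
     \<mu> \<cdot>\<^bsub>C\<^esub> (\<nu> \<otimes>\<^bsub>C\<^esub> Idt C V) = Idt C V \<and>
     \<mu> \<cdot>\<^bsub>C\<^esub> (Idt C V \<otimes>\<^bsub>C\<^esub> \<nu>) = Idt C V"

definition normalized_pair :: "('o, 'm, 'z) smc_scheme \<Rightarrow> 'o \<Rightarrow> 'm \<Rightarrow> 'm \<Rightarrow> bool" where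
  "normalized_pair C V \<eta> \<epsilon> \<longleftrightarrow>
     \<eta> \<in> Hom C (Unit C) V \<and> \<epsilon> \<in> Hom C V (Unit C) \<and> \<epsilon> \<cdot>\<^bsub>C\<^esub> \<eta> = Idt C (Unit C)"

text \<open>Naturality of \<open>\<xi> : V \<otimes> W \<rightarrow> W \<otimes> V\<close> with respect to \<open>\<phi> : V\<^sup>n \<rightarrow> V\<^sup>m\<close>, respectively
  \<open>\<psi> : W\<^sup>n \<rightarrow> W\<^sup>m\<close> (tensor powers): the braidings are \<open>\<xi>\<^sup>1 \<cdots> \<xi>\<^sup>n\<close> on \<open>V\<^sup>n \<otimes> W\<close> and
  \<open>\<xi>\<^sup>n \<cdots> \<xi>\<^sup>1\<close> on \<open>V \<otimes> W\<^sup>n\<close>.\<close>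

definition natural_fst ::
  "('o, 'm, 'z) smc_scheme \<Rightarrow> 'o \<Rightarrow> 'o \<Rightarrow> 'm \<Rightarrow> nat \<Rightarrow> nat \<Rightarrow> 'm \<Rightarrow> bool" where
  "natural_fst C V W \<xi> n m \<phi> \<longleftrightarrow>
     braid_comp C (map (\<lambda>p. (\<xi>, p)) [1..<m+1]) (replicate m V @ [W]) \<cdot>\<^bsub>C\<^esub> (\<phi> \<otimes>\<^bsub>C\<^esub> Idt C W)
     = (Idt C W \<otimes>\<^bsub>C\<^esub> \<phi>) \<cdot>\<^bsub>C\<^esub> braid_comp C (map (\<lambda>p. (\<xi>, p)) [1..<n+1]) (replicate n V @ [W])"

definition natural_snd ::
  "('o, 'm, 'z) smc_scheme \<Rightarrow> 'o \<Rightarrow> 'o \<Rightarrow> 'm \<Rightarrow> nat \<Rightarrow> nat \<Rightarrow> 'm \<Rightarrow> bool" where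
  "natural_snd C V W \<xi> n m \<psi> \<longleftrightarrow>
     braid_comp C (map (\<lambda>p. (\<xi>, p)) (rev [1..<m+1])) (V # replicate m W) \<cdot>\<^bsub>C\<^esub> (Idt C V \<otimes>\<^bsub>C\<^esub> \<psi>)
     = (\<psi> \<otimes>\<^bsub>C\<^esub> Idt C V) \<cdot>\<^bsub>C\<^esub> braid_comp C (map (\<lambda>p. (\<xi>, p)) (rev [1..<n+1])) (V # replicate n W)"

definition colored_YBE ::
  "('o, 'm, 'z) smc_scheme \<Rightarrow> (nat \<Rightarrow> 'o) \<Rightarrow> (nat \<Rightarrow> nat \<Rightarrow> 'm) \<Rightarrow> nat \<Rightarrow> nat \<Rightarrow> nat \<Rightarrow> bool" where
  "colored_YBE C V \<sigma> i j k \<longleftrightarrow>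
     (\<sigma> j k \<otimes>\<^bsub>C\<^esub> Idt C (V i)) \<cdot>\<^bsub>C\<^esub> (Idt C (V j) \<otimes>\<^bsub>C\<^esub> \<sigma> i k) \<cdot>\<^bsub>C\<^esub> (\<sigma> i j \<otimes>\<^bsub>C\<^esub> Idt C (V k))
     = (Idt C (V k) \<otimes>\<^bsub>C\<^esub> \<sigma> i j) \<cdot>\<^bsub>C\<^esub> (\<sigma> i k \<otimes>\<^bsub>C\<^esub> Idt C (V j)) \<cdot>\<^bsub>C\<^esub> (Idt C (V i) \<otimes>\<^bsub>C\<^esub> \<sigma> j k)"

text \<open>Families indexed by \<open>1, \<dots>, r\<close> are functions on \<^typ>\<open>nat\<close> whose values outside the stated
  index range are irrelevant.\<close>

definition braided_system ::
  "('o, 'm, 'z) smc_scheme \<Rightarrow> nat \<Rightarrow> (nat \<Rightarrow> 'o) \<Rightarrow> (nat \<Rightarrow> nat \<Rightarrow> 'm) \<Rightarrow> bool" where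
  "braided_system C r V \<sigma> \<longleftrightarrow>
     (\<forall>i. 1 \<le> i \<and> i \<le> r \<longrightarrow> V i \<in> Obj C) \<and>
     (\<forall>i j. 1 \<le> i \<and> i \<le> j \<and> j \<le> r \<longrightarrow> \<sigma> i j \<in> Hom C (V i \<odot>\<^bsub>C\<^esub> V j) (V j \<odot>\<^bsub>C\<^esub> V i)) \<and>
     (\<forall>i j k. 1 \<le> i \<and> i \<le> j \<and> j \<le> k \<and> k \<le> r \<longrightarrow> colored_YBE C V \<sigma> i j k)"

definition pointed_braided_system ::
  "('o, 'm, 'z) smc_scheme \<Rightarrow> nat \<Rightarrow> (nat \<Rightarrow> 'o) \<Rightarrow> (nat \<Rightarrow> nat \<Rightarrow> 'm) \<Rightarrow> (nat \<Rightarrow> 'm) \<Rightarrow> bool" where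
  "pointed_braided_system C r V \<sigma> \<nu> \<longleftrightarrow>
     braided_system C r V \<sigma> \<and> (\<forall>i. 1 \<le> i \<and> i \<le> r \<longrightarrow> \<nu> i \<in> Hom C (Unit C) (V i))"

definition sigma_Ass :: "('o, 'm, 'z) smc_scheme \<Rightarrow> 'm \<Rightarrow> 'm \<Rightarrow> 'm" where
  "sigma_Ass C \<mu> \<nu> = \<nu> \<otimes>\<^bsub>C\<^esub> \<mu>"


section \<open>The structure on the reversed tensor product\<close>

definition rev_obj :: "('o, 'm, 'z) smc_scheme \<Rightarrow> nat \<Rightarrow> (nat \<Rightarrow> 'o) \<Rightarrow> 'o" where
  "rev_obj C r V = otens_list C (map V (rev [1..<r+1]))"

text \<open>The list is \<open>\<xi>\<^sub>1\<^sub>,\<^sub>2\<close>; \<open>\<xi>\<^sub>2\<^sub>,\<^sub>3\<close>, \<open>\<xi>\<^sub>1\<^sub>,\<^sub>3\<close>; up to \<open>\<xi>\<^sub>r\<^sub>-\<^sub>1\<^sub>,\<^sub>r\<close>, ..., \<open>\<xi>\<^sub>1\<^sub>,\<^sub>r\<close>. When \<open>\<xi>\<^sub>i\<^sub>,\<^sub>j\<close> is applied, the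
  two letters it interchanges are at positions \<open>2r+1-i-j\<close> and \<open>2r+2-i-j\<close>, which gives the exponents
  \<open>2r-2\<close>; \<open>2r-4\<close>, \<open>2r-3\<close>; ...; \<open>2\<close>, ..., \<open>r\<close>.\<close>

definition rev_mult ::
  "('o, 'm, 'z) smc_scheme \<Rightarrow> nat \<Rightarrow> (nat \<Rightarrow> 'o) \<Rightarrow> (nat \<Rightarrow> 'm) \<Rightarrow> (nat \<Rightarrow> nat \<Rightarrow> 'm) \<Rightarrow> 'm" where
  "rev_mult C r V \<mu> \<xi> =
     mtens_list C (map \<mu> (rev [1..<r+1])) \<cdot>\<^bsub>C\<^esub>
     braid_comp C
       (concat (map (\<lambda>j. map (\<lambda>i. (\<xi> i j, 2 * r + 1 - i - j)) (rev [1..<j])) [2..<r+1]))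
       (map V (rev [1..<r+1]) @ map V (rev [1..<r+1]))"

definition rev_unit :: "('o, 'm, 'z) smc_scheme \<Rightarrow> nat \<Rightarrow> (nat \<Rightarrow> 'm) \<Rightarrow> 'm" where
  "rev_unit C r \<nu> = mtens_list C (map \<nu> (rev [1..<r+1]))"

end

theory Submission
  imports Defs
begin

text \<open>
  Let \<open>A n = V n \<odot> \<dots> \<odot> V 1\<close>. The idea is to see the multiplication of \<open>A n\<close> as an iterated construction. The product
  on \<open>A (n+1) = V (n+1) \<odot> A n\<close> is the twisted tensor product (\<open>twisted_mult\<close>) of two algebras, in which the
  composite \<open>sweep\<close> of the morphisms \<open>\<xi> i (n+1)\<close> moves \<open>V (n+1)\<close> past \<open>A n\<close>. This is \<open>rev_mult_Suc\<close>, and it reduces the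
  theorem to the case of two factors and an induction on \<open>n\<close>.

  For two unital algebras \<open>B\<close> and \<open>A\<close> and \<open>t : A \<odot> B \<rightarrow> B \<odot> A\<close> natural with respect to the units, the twisted product is
  associative if \<open>t\<close> is natural with respect to both multiplications (\<open>twisted_mult_assoc\<close>). Conversely,
  associativity evaluated on elements of the form \<open>1 \<otimes> a\<close> and \<open>b \<otimes> 1\<close> returns both naturality conditions
  (\<open>twisted_mult_assoc_imp\<close>).

  From (B) to (C): \<open>sweep\<close> must be natural with respect to \<open>\<mu> (n+1)\<close> and to the multiplication of \<open>A n\<close>. The former follows
  factor by factor. The latter follows by induction from naturality with respect to each \<open>\<mu> i\<close> and from the
  Yang-Baxter equation, which is needed with a tensor product \<open>A l\<close> in its first variable
  (\<open>cable_natural_fst_twisted_mult\<close>, \<open>cable_yang_baxter\<close>).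

  From (C) to (B): the normalized pairs make \<open>V i\<close> a split subalgebra of \<open>A n\<close>, and \<open>A n\<close> one of \<open>A (n+1)\<close>, so that
  associativity descends and the naturality of \<open>sweep\<close> restricts to naturality of \<open>\<xi> i (n+1)\<close>. For \<open>i < j\<close>
  the products of \<open>V i\<close> and \<open>V j\<close> inside \<open>A n\<close> in the two possible orders differ exactly by \<open>\<xi> i j\<close>. Moving \<open>V (n+1)\<close> past
  such a product in both descriptions produces the two sides of the Yang-Baxter equation, followed by a split
  monomorphism (\<open>yang_baxter_restrict\<close>).

  (A) and (B) are compared one equation at a time. For the diagonal morphisms \<open>\<nu> i \<otimes> \<mu> i\<close>, the Yang-Baxter equation with
  two equal indices is a naturality equation tensored with a unit, which the normalized pair cancels, and
  the one with three equal indices follows from associativity of \<open>\<mu> i\<close>.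
\<close>

section \<open>Chains of whiskered morphisms\<close>

context strict_monoidal_category
begin

lemma HomD:
  assumes "f \<in> Hom C a b"
  shows "f \<in> Mor C" "Dom C f = a" "Cod C f = b" "a \<in> Obj C" "b \<in> Obj C"
  using assms dom_closed cod_closed by (auto simp: Hom_def)

lemma HomI: "f \<in> Mor C \<Longrightarrow> Dom C f = a \<Longrightarrow> Cod C f = b \<Longrightarrow> f \<in> Hom C a b"
  by (auto simp: Hom_def)

lemma Mor_Hom: "f \<in> Mor C \<Longrightarrow> f \<in> Hom C (Dom C f) (Cod C f)"
  by (auto simp: Hom_def)

lemma id_simps:
  assumes "a \<in> Obj C"
  shows "Id a \<in> Mor C" "Dom C (Id a) = a" "Cod C (Id a) = a"
  using HomD[OF id_hom[OF assms]] by auto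

lemma comp_simps:
  assumes "f \<in> Mor C" "g \<in> Mor C" "Cod C f = Dom C g"
  shows "g \<cdot> f \<in> Mor C" "Dom C (g \<cdot> f) = Dom C f" "Cod C (g \<cdot> f) = Cod C g"
  using HomD[OF comp_hom[OF Mor_Hom[OF assms(1)], of g "Cod C g"]] assms by (auto simp: Hom_def)

lemma tens_simps:
  assumes "f \<in> Mor C" "g \<in> Mor C"
  shows "f \<otimes> g \<in> Mor C" "Dom C (f \<otimes> g) = Dom C f \<odot> Dom C g"
    "Cod C (f \<otimes> g) = Cod C f \<odot> Cod C g"
  using HomD[OF mtens_hom[OF Mor_Hom[OF assms(1)] Mor_Hom[OF assms(2)]]] by auto

lemma comp_rules:
  shows "f \<in> Mor C \<Longrightarrow> Cod C f = a \<Longrightarrow> Id a \<cdot> f = f"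
    and "f \<in> Mor C \<Longrightarrow> Dom C f = a \<Longrightarrow> f \<cdot> Id a = f"
    and "\<lbrakk>f \<in> Mor C; g \<in> Mor C; h \<in> Mor C; Cod C f = Dom C g; Cod C g = Dom C h\<rbrakk>
      \<Longrightarrow> (h \<cdot> g) \<cdot> f = h \<cdot> (g \<cdot> f)"
  using comp_id_left comp_id_right comp_assoc by (auto simp: Hom_def)

definition whisker :: "'o \<Rightarrow> 'm \<Rightarrow> 'o \<Rightarrow> 'm" ("(_ \<lhd>/ _ \<rhd>/ _)" [73, 74, 73] 72) where
  "x \<lhd> f \<rhd> y = Id x \<otimes> f \<otimes> Id y"

lemma whisker_simps:
  assumes "x \<in> Obj C" "y \<in> Obj C" "f \<in> Mor C"
  shows "x \<lhd> f \<rhd> y \<in> Mor C" "Dom C (x \<lhd> f \<rhd> y) = x \<odot> Dom C f \<odot> y"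
    "Cod C (x \<lhd> f \<rhd> y) = x \<odot> Cod C f \<odot> y"
  using assms by (simp_all add: whisker_def tens_simps id_simps)

lemma interchange:
  assumes "f \<in> Mor C" "g \<in> Mor C" "f' \<in> Mor C" "g' \<in> Mor C" "Cod C f = Dom C g" "Cod C f' = Dom C g'"
  shows "(g \<otimes> g') \<cdot> (f \<otimes> f') = (g \<cdot> f) \<otimes> (g' \<cdot> f')"
  using mtens_comp[of f "Dom C f" "Cod C f" g "Cod C g" f' "Dom C f'" "Cod C f'" g' "Cod C g'"] assms
  by (simp add: Hom_def)

lemma comp_tens_comp:
  assumes "f \<in> Hom C a b" "g \<in> Hom C b c" "f' \<in> Hom C a' b'" "g' \<in> Hom C b' c'" "k \<in> Hom C (c \<odot> c') d"
  shows "k \<cdot> ((g \<cdot> f) \<otimes> (g' \<cdot> f')) = (k \<cdot> (g \<otimes> g')) \<cdot> (f \<otimes> f')"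
  using comp_assoc[OF mtens_hom[OF assms(1,3)] mtens_hom[OF assms(2,4)] assms(5)] mtens_comp[OF assms(1-4)]
  by simp

lemma whisker_comp:
  assumes "x \<in> Obj C" "y \<in> Obj C" "f \<in> Mor C" "g \<in> Mor C" "Cod C f = Dom C g"
  shows "x \<lhd> (g \<cdot> f) \<rhd> y = (x \<lhd> g \<rhd> y) \<cdot> (x \<lhd> f \<rhd> y)"
  using assms
  by (simp add: whisker_def interchange comp_rules id_simps tens_simps)

lemma whisker_whisker:
  assumes "x \<in> Obj C" "y \<in> Obj C" "u \<in> Obj C" "v \<in> Obj C" "f \<in> Mor C"
  shows "x \<lhd> (u \<lhd> f \<rhd> v) \<rhd> y = (x \<odot> u) \<lhd> f \<rhd> (v \<odot> y)"
  using assms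
  by (simp add: whisker_def mtens_id[symmetric] mtens_assoc id_simps tens_simps)

lemma whisker_unit: "f \<in> Mor C \<Longrightarrow> \<I> \<lhd> f \<rhd> \<I> = f"
  by (simp add: whisker_def mtens_unit_left mtens_unit_right)

lemma whisker_id: "x \<in> Obj C \<Longrightarrow> y \<in> Obj C \<Longrightarrow> a \<in> Obj C \<Longrightarrow> x \<lhd> Id a \<rhd> y = Id (x \<odot> a \<odot> y)"
  by (simp add: whisker_def mtens_id otens_obj)

lemma tens_as_whiskers:
  assumes "f \<in> Mor C" "g \<in> Mor C"
  shows "f \<otimes> g = (\<I> \<lhd> f \<rhd> Cod C g) \<cdot> (Dom C f \<lhd> g \<rhd> \<I>)"
  using assms
  by (simp add: whisker_def mtens_unit_left mtens_unit_right interchange id_simps tens_simps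
      comp_rules dom_closed cod_closed unit_obj)

text \<open>Disjoint morphisms commute: \<open>f\<close> acts on a block to the left of the block on which \<open>g\<close> acts, and \<open>z\<close> is
  what lies between the two blocks.\<close>

lemma exchange:
  assumes "f \<in> Hom C a b" "g \<in> Hom C c d" "x \<in> Obj C" "y \<in> Obj C" "z \<in> Obj C"
  shows "(x \<lhd> f \<rhd> (z \<odot> d \<odot> y)) \<cdot> ((x \<odot> a \<odot> z) \<lhd> g \<rhd> y)
       = ((x \<odot> b \<odot> z) \<lhd> g \<rhd> y) \<cdot> (x \<lhd> f \<rhd> (z \<odot> c \<odot> y))"
proof -
  note o = HomD[OF assms(1)] HomD[OF assms(2)] assms(3-)
  have "(x \<lhd> f \<rhd> (z \<odot> d \<odot> y)) \<cdot> ((x \<odot> a \<odot> z) \<lhd> g \<rhd> y) = Id x \<otimes> f \<otimes> Id z \<otimes> g \<otimes> Id y"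
    using o by (simp add: whisker_def mtens_id[symmetric] otens_obj mtens_assoc interchange id_simps tens_simps
      comp_rules)
  also have "\<dots> = ((x \<odot> b \<odot> z) \<lhd> g \<rhd> y) \<cdot> (x \<lhd> f \<rhd> (z \<odot> c \<odot> y))"
    using o by (simp add: whisker_def mtens_id[symmetric] otens_obj mtens_assoc interchange id_simps tens_simps
      comp_rules)
  finally show ?thesis .
qed

text \<open>Composition is made total by adjoining a zero, \<open>None\<close>, as the value of composites that do not
  type. It is then associative without side conditions, and the type of a composite is
  computed from the types of its factors alone. Directly on \<open>Mor C\<close>, each re-association needs the source and
  target of nested composites again, at a cost that doubles with every factor.\<close>

definition hom_type :: "'m option \<Rightarrow> ('o \<times> 'o) option" where
  "hom_type F = (case F of None \<Rightarrow> None | Some f \<Rightarrow> if f \<in> Mor C then Some (Dom C f, Cod C f) else None)"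

definition seq :: "'m option \<Rightarrow> 'm option \<Rightarrow> 'm option" (infixr "\<star>" 65) where
  "G \<star> F = (case hom_type G of None \<Rightarrow> None | Some (b', c) \<Rightarrow>
     (case hom_type F of None \<Rightarrow> None | Some (a, b) \<Rightarrow>
       if b = b' then Some (the G \<cdot> the F) else None))"

definition layer :: "'o \<Rightarrow> 'm option \<Rightarrow> 'o \<Rightarrow> 'm option" where
  "layer x F y = (if x \<in> Obj C \<and> y \<in> Obj C \<and> hom_type F \<noteq> None then Some (x \<lhd> the F \<rhd> y) else None)"

definition source :: "'m option \<Rightarrow> 'o" where
  "source F = fst (the (hom_type F))"
definition target :: "'m option \<Rightarrow> 'o" where
  "target F = snd (the (hom_type F))"

lemma hom_type_seq: "hom_type (G \<star> F) = (case hom_type G of None \<Rightarrow> None | Some (b', c) \<Rightarrow>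
     (case hom_type F of None \<Rightarrow> None | Some (a, b) \<Rightarrow> if b = b' then Some (a, c) else None))"
  by (auto simp: seq_def hom_type_def comp_simps split: option.splits)

lemma hom_type_layer: "hom_type (layer x F y) = (case hom_type F of None \<Rightarrow> None | Some (a, b) \<Rightarrow>
     if x \<in> Obj C \<and> y \<in> Obj C then Some (x \<odot> a \<odot> y, x \<odot> b \<odot> y) else None)"
  by (auto simp: layer_def hom_type_def whisker_simps split: option.splits)

lemma hom_type_Hom: "f \<in> Hom C a b \<Longrightarrow> hom_type (Some f) = Some (a, b)"
  by (auto simp: hom_type_def Hom_def)

lemma hom_type_Id: "a \<in> Obj C \<Longrightarrow> hom_type (Some (Id a)) = Some (a, a)"
  by (simp add: hom_type_Hom id_hom)

lemma seq_assoc: "(H \<star> G) \<star> F = H \<star> (G \<star> F)"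
proof (cases "hom_type F = None \<or> hom_type G = None \<or> hom_type H = None")
  case True
  then show ?thesis
   by (auto simp: seq_def[of "H \<star> G"] seq_def[of H "G \<star> F"] hom_type_seq split: option.splits)
next
  case False
  then obtain f g h where "F = Some f" "G = Some g" "H = Some h" "f \<in> Mor C" "g \<in> Mor C" "h \<in> Mor C"
    by (auto simp: hom_type_def split: option.splits if_splits)
  then show ?thesis
    by (auto simp: seq_def hom_type_def comp_simps comp_rules)
qed

lemma Some_comp: "hom_type (Some g \<star> Some f) \<noteq> None \<Longrightarrow> Some (g \<cdot> f) = Some g \<star> Some f"
  by (auto simp: hom_type_def seq_def split: if_splits option.splits)

lemma Some_tens: "hom_type (Some f) \<noteq> None \<Longrightarrow> hom_type (Some g) \<noteq> None \<Longrightarrow>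
   Some (f \<otimes> g) = layer \<I> (Some f) (target (Some g)) \<star> layer (source (Some f)) (Some g) \<I>"
  by (auto simp: hom_type_def seq_def tens_as_whiskers layer_def target_def source_def dom_closed cod_closed unit_obj
     whisker_simps otens_obj otens_unit_left otens_unit_right split: if_splits option.splits)

text \<open>The zero composite has to be excluded: if source and target of the two factors differ, they may still
  become equal after tensoring with \<open>x\<close> and \<open>y\<close>.\<close>

lemma layer_seq: "hom_type (G \<star> F) \<noteq> None \<Longrightarrow> layer x (G \<star> F) y = layer x G y \<star> layer x F y"
  by (auto simp: layer_def seq_def hom_type_def comp_simps whisker_simps whisker_comp split: if_splits option.splits)

lemma layer_layer: "x \<in> Obj C \<Longrightarrow> y \<in> Obj C \<Longrightarrow> u \<in> Obj C \<Longrightarrow> v \<in> Obj C \<Longrightarrow>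
   layer x (layer u F v) y = layer (x \<odot> u) F (v \<odot> y)"
  by (auto simp: layer_def hom_type_def whisker_whisker whisker_simps otens_obj split: if_splits option.splits)

lemma layer_unit: "hom_type F \<noteq> None \<Longrightarrow> layer \<I> F \<I> = F"
  by (auto simp: layer_def hom_type_def whisker_unit unit_obj split: if_splits option.splits)

lemma layer_Id: "x \<in> Obj C \<Longrightarrow> y \<in> Obj C \<Longrightarrow> a \<in> Obj C \<Longrightarrow> layer x (Some (Id a)) y = Some (Id (x \<odot> a \<odot> y))"
  by (simp add: layer_def hom_type_Id whisker_id)

lemma seq_Id_left: "hom_type F \<noteq> None \<Longrightarrow> target F = a \<Longrightarrow> Some (Id a) \<star> F = F"
  by (auto simp: seq_def hom_type_def target_def id_simps cod_closed comp_rules split: if_splits option.splits)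

lemma seq_Id_right: "hom_type F \<noteq> None \<Longrightarrow> source F = a \<Longrightarrow> F \<star> Some (Id a) = F"
  by (auto simp: seq_def hom_type_def source_def id_simps dom_closed comp_rules split: if_splits option.splits)

lemma layer_exchange:
  assumes "f \<in> Hom C a b" "g \<in> Hom C c d" "x \<in> Obj C" "y \<in> Obj C" "z \<in> Obj C"
  shows "layer x (Some f) (z \<odot> d \<odot> y) \<star> layer (x \<odot> a \<odot> z) (Some g) y
       = layer (x \<odot> b \<odot> z) (Some g) y \<star> layer x (Some f) (z \<odot> c \<odot> y)"
  using exchange[OF assms] HomD[OF assms(1)] HomD[OF assms(2)] assms(3-)
  by (simp add: layer_def seq_def hom_type_def otens_obj whisker_simps otens_assoc)

text \<open>Under \<open>layer_simps\<close>, both sides of an equation between composites of tensor products become right-nested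
  \<open>\<star>\<close>-chains of layers \<open>layer x (Some f) y\<close> with \<open>f\<close> one of the given morphisms. An equation used as a rewrite rule
  in the middle of such a chain is needed in two forms, whiskered by the surrounding objects (\<open>layer_cong\<close>) and
  followed by a tail (\<open>seq_tail\<close>).

  The diagrammatic proofs all have the same shape: \<open>rules\<close> collects the whiskered
  hypotheses and those instances of \<open>layer_exchange\<close> that occur in the diagram, and rewriting brings both sides
  to the same chain. The exchange instances are mostly used from right to left (\<open>symmetric\<close>), which makes
  the left one of two commuting morphisms act last; the opposite direction is chosen where the right one
  has to act last, for instance a unit or an inclusion that is carried through to the morphism absorbing it.\<close>

lemma seq_tail: "G = H \<Longrightarrow> G \<star> T = H \<star> T"
  by simp

lemma layer_cong: "f = g \<Longrightarrow> layer x (Some f) y = layer x (Some g) y"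
  by simp

lemmas object_simps = otens_obj unit_obj otens_assoc otens_unit_left otens_unit_right
lemmas layer_simps = hom_type_seq hom_type_layer hom_type_Id seq_assoc Some_comp Some_tens
  layer_seq layer_layer layer_unit layer_Id seq_Id_left seq_Id_right object_simps target_def source_def

lemma eqI_Some: "Some f = Some g \<Longrightarrow> f = g" by simp

section \<open>Naturality and the Yang-Baxter equation as plain equations\<close>

lemma otens_list_simps:
  "otens_list C [] = \<I>" "otens_list C (w # ws) = w \<odot> otens_list C ws"
  by (simp_all add: otens_list_def)

lemma natural_unit_iff:
  assumes "V \<in> Obj C" "W \<in> Obj C" "s \<in> Hom C (V \<odot> W) (W \<odot> V)"
  shows "n \<in> Hom C \<I> V \<Longrightarrow> natural_fst C V W s 0 1 n \<longleftrightarrow> s \<cdot> (n \<otimes> Id W) = Id W \<otimes> n"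
    and "n \<in> Hom C \<I> W \<Longrightarrow> natural_snd C V W s 0 1 n \<longleftrightarrow> s \<cdot> (Id V \<otimes> n) = n \<otimes> Id V"
  using assms HomD[OF assms(3)] HomD[of n \<I> V] HomD[of n \<I> W]
  by (auto simp: natural_fst_def natural_snd_def act_at_def otens_list_simps object_simps comp_rules
      id_simps tens_simps mtens_unit_left mtens_unit_right)

lemma natural_mult_iff:
  assumes "V \<in> Obj C" "W \<in> Obj C" "s \<in> Hom C (V \<odot> W) (W \<odot> V)"
  shows "natural_fst C V W s 2 1 m \<longleftrightarrow> s \<cdot> (m \<otimes> Id W) = (Id W \<otimes> m) \<cdot> (s \<otimes> Id V) \<cdot> (Id V \<otimes> s)"
    and "natural_snd C V W s 2 1 m \<longleftrightarrow> s \<cdot> (Id V \<otimes> m) = (m \<otimes> Id V) \<cdot> (Id W \<otimes> s) \<cdot> (s \<otimes> Id W)"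
proof -
  have u: "[Suc 0..<3] = [1,2]" by (simp add: upt_rec)
  show "natural_fst C V W s 2 1 m \<longleftrightarrow> s \<cdot> (m \<otimes> Id W) = (Id W \<otimes> m) \<cdot> (s \<otimes> Id V) \<cdot> (Id V \<otimes> s)"
    and "natural_snd C V W s 2 1 m \<longleftrightarrow> s \<cdot> (Id V \<otimes> m) = (m \<otimes> Id V) \<cdot> (Id W \<otimes> s) \<cdot> (s \<otimes> Id W)"
    using assms(1,2) HomD[OF assms(3)]
    by (auto simp: natural_fst_def natural_snd_def act_at_def swap_at_def otens_list_simps object_simps
      comp_rules id_simps tens_simps mtens_unit_left mtens_unit_right numeral_2_eq_2 u)
qed

text \<open>The colored equation for three objects that need not belong to an indexed family; it is needed on tensor
  products of members.\<close>

definition yang_baxter :: "'o \<Rightarrow> 'o \<Rightarrow> 'o \<Rightarrow> 'm \<Rightarrow> 'm \<Rightarrow> 'm \<Rightarrow> bool" where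
  "yang_baxter X Y Z xy xz yz \<longleftrightarrow>
     (yz \<otimes> Id X) \<cdot> (Id Y \<otimes> xz) \<cdot> (xy \<otimes> Id Z) = (Id Z \<otimes> xy) \<cdot> (xz \<otimes> Id Y) \<cdot> (Id X \<otimes> yz)"

section \<open>Moving an object past a tensor product\<close>

text \<open>Moves an object past \<open>B \<odot> A\<close>, given a morphism \<open>s\<close> that moves it past \<open>B\<close> and a morphism \<open>b\<close> that moves it past \<open>A\<close>.\<close>

definition cable :: "'o \<Rightarrow> 'o \<Rightarrow> 'm \<Rightarrow> 'm \<Rightarrow> 'm" where
  "cable B A s b = (s \<otimes> Id A) \<cdot> (Id B \<otimes> b)"

text \<open>The twisted tensor product of two algebras: \<open>t\<close> moves the first \<open>A\<close> past the second \<open>B\<close>, after which both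
  multiplications act.\<close>

definition twisted_mult :: "'o \<Rightarrow> 'o \<Rightarrow> 'm \<Rightarrow> 'm \<Rightarrow> 'm \<Rightarrow> 'm" where
  "twisted_mult B A mB mA t = (mB \<otimes> mA) \<cdot> (Id B \<otimes> t \<otimes> Id A)"

lemma cable_Hom:
  assumes "s \<in> Hom C (B \<odot> W) (W \<odot> B)" "b \<in> Hom C (A \<odot> W) (W \<odot> A)"
    "A \<in> Obj C" "B \<in> Obj C" "W \<in> Obj C"
  shows "cable B A s b \<in> Hom C ((B \<odot> A) \<odot> W) (W \<odot> (B \<odot> A))"
  using HomD[OF assms(1)] HomD[OF assms(2)] assms(3-)
  by (intro HomI) (simp_all add: cable_def tens_simps comp_simps id_simps object_simps)

lemma twisted_mult_Hom:
  assumes "mB \<in> Hom C (B \<odot> B) B" "mA \<in> Hom C (A \<odot> A) A" "t \<in> Hom C (A \<odot> B) (B \<odot> A)"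
    "A \<in> Obj C" "B \<in> Obj C"
  shows "twisted_mult B A mB mA t \<in> Hom C ((B \<odot> A) \<odot> (B \<odot> A)) (B \<odot> A)"
  using HomD[OF assms(1)] HomD[OF assms(2)] HomD[OF assms(3)] assms(4-)
  by (intro HomI) (simp_all add: twisted_mult_def tens_simps comp_simps id_simps object_simps)

context
  fixes A B W s b
  assumes o: "A \<in> Obj C" "B \<in> Obj C" "W \<in> Obj C"
    and s: "s \<in> Hom C (B \<odot> W) (W \<odot> B)" and b: "b \<in> Hom C (A \<odot> W) (W \<odot> A)"
begin

lemma cable_natural_snd_unit:
  assumes n: "n \<in> Hom C \<I> W"
    and sn: "s \<cdot> (Id B \<otimes> n) = n \<otimes> Id B" and bn: "b \<cdot> (Id A \<otimes> n) = n \<otimes> Id A"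
  shows "cable B A s b \<cdot> (Id (B \<odot> A) \<otimes> n) = n \<otimes> Id (B \<odot> A)"
proof -
  note [simp] = layer_simps o hom_type_Hom[OF s] hom_type_Hom[OF b] hom_type_Hom[OF n]
  note rules = layer_cong[OF sn, of \<I> A, simplified] layer_cong[OF bn, of B \<I>, simplified]
  show ?thesis
    unfolding cable_def
    by (rule eqI_Some) (simp add: rules rules[THEN seq_tail, simplified seq_assoc])
qed

lemma cable_natural_fst_unit:
  assumes nA: "nA \<in> Hom C \<I> A" and nB: "nB \<in> Hom C \<I> B"
    and sn: "s \<cdot> (nB \<otimes> Id W) = Id W \<otimes> nB" and bn: "b \<cdot> (nA \<otimes> Id W) = Id W \<otimes> nA"
  shows "cable B A s b \<cdot> ((nB \<otimes> nA) \<otimes> Id W) = Id W \<otimes> (nB \<otimes> nA)"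
proof -
  note [simp] = layer_simps o hom_type_Hom[OF s] hom_type_Hom[OF b] hom_type_Hom[OF nA] hom_type_Hom[OF nB]
  note rules = layer_cong[OF sn, of \<I> A, simplified] layer_cong[OF bn, of \<I> \<I>, simplified]
     layer_exchange[OF nB b, of \<I> \<I> \<I>, symmetric, simplified]
  show ?thesis
    unfolding cable_def
    by (rule eqI_Some) (simp add: rules rules[THEN seq_tail, simplified seq_assoc])
qed

lemma cable_natural_snd_mult:
  assumes m: "m \<in> Hom C (W \<odot> W) W"
    and sm: "s \<cdot> (Id B \<otimes> m) = (m \<otimes> Id B) \<cdot> (Id W \<otimes> s) \<cdot> (s \<otimes> Id W)"
    and bm: "b \<cdot> (Id A \<otimes> m) = (m \<otimes> Id A) \<cdot> (Id W \<otimes> b) \<cdot> (b \<otimes> Id W)"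
  shows "cable B A s b \<cdot> (Id (B \<odot> A) \<otimes> m)
    = (m \<otimes> Id (B \<odot> A)) \<cdot> (Id W \<otimes> cable B A s b) \<cdot> (cable B A s b \<otimes> Id W)"
proof -
  note [simp] = layer_simps o hom_type_Hom[OF s] hom_type_Hom[OF b] hom_type_Hom[OF m]
  note rules = layer_cong[OF sm, of \<I> A, simplified] layer_cong[OF bm, of B \<I>, simplified]
     layer_exchange[OF s b, of \<I> \<I> \<I>, symmetric, simplified]
  show ?thesis
    unfolding cable_def
    by (rule eqI_Some) (simp add: rules rules[THEN seq_tail, simplified seq_assoc])
qed

text \<open>Moving \<open>W\<close> past a product in \<open>B \<odot> A\<close> uses naturality in each factor; the remaining discrepancy is that \<open>t\<close> has
  been applied before instead of after \<open>W\<close> passes, which the Yang-Baxter equation on \<open>A\<close>, \<open>B\<close>, \<open>W\<close> corrects.\<close>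

lemma cable_natural_fst_twisted_mult:
  assumes t: "t \<in> Hom C (A \<odot> B) (B \<odot> A)" and mA: "mA \<in> Hom C (A \<odot> A) A" and mB: "mB \<in> Hom C (B \<odot> B) B"
    and bm: "b \<cdot> (mA \<otimes> Id W) = (Id W \<otimes> mA) \<cdot> (b \<otimes> Id A) \<cdot> (Id A \<otimes> b)"
    and sm: "s \<cdot> (mB \<otimes> Id W) = (Id W \<otimes> mB) \<cdot> (s \<otimes> Id B) \<cdot> (Id B \<otimes> s)"
    and y: "yang_baxter A B W t b s"
  shows "cable B A s b \<cdot> (twisted_mult B A mB mA t \<otimes> Id W)
    = (Id W \<otimes> twisted_mult B A mB mA t) \<cdot> (cable B A s b \<otimes> Id (B \<odot> A)) \<cdot> (Id (B \<odot> A) \<otimes> cable B A s b)"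
proof -
  note [simp] = layer_simps o hom_type_Hom[OF s] hom_type_Hom[OF b] hom_type_Hom[OF t]
    hom_type_Hom[OF mA] hom_type_Hom[OF mB]
  note rules = layer_cong[OF bm, of "B \<odot> B" \<I>, simplified] layer_cong[OF sm, of \<I> A, simplified]
     layer_cong[OF y[unfolded yang_baxter_def], of B A, symmetric, simplified]
     layer_exchange[OF mB b, of \<I> \<I> \<I>, symmetric, simplified]
     layer_exchange[OF s t, of \<I> A \<I>, symmetric, simplified]
     layer_exchange[OF s mA, of \<I> \<I> B, symmetric, simplified]
     layer_exchange[OF s mA, of B \<I> \<I>, symmetric, simplified]
     layer_exchange[OF t b, of B \<I> \<I>, symmetric, simplified]
  show ?thesis
    unfolding cable_def twisted_mult_def
    by (rule eqI_Some) (simp add: rules rules[THEN seq_tail, simplified seq_assoc])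
qed

text \<open>The Yang-Baxter equation is inherited by tensor products in its first variable: the two equations are
  applied one after the other, with an exchange of disjoint morphisms before and after.\<close>

lemma cable_yang_baxter:
  assumes J: "J \<in> Obj C" and x: "x \<in> Hom C (J \<odot> W) (W \<odot> J)"
    and p: "p \<in> Hom C (B \<odot> J) (J \<odot> B)" and q: "q \<in> Hom C (A \<odot> J) (J \<odot> A)"
    and yB: "yang_baxter B J W p s x" and yA: "yang_baxter A J W q b x"
  shows "yang_baxter (B \<odot> A) J W (cable B A p q) (cable B A s b) x"
proof -
  note [simp] = layer_simps o J hom_type_Hom[OF s] hom_type_Hom[OF b] hom_type_Hom[OF x]
    hom_type_Hom[OF p] hom_type_Hom[OF q]
  note rules = layer_cong[OF yB[unfolded yang_baxter_def], of \<I> A, simplified]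
     layer_cong[OF yA[unfolded yang_baxter_def], of B \<I>, simplified]
     layer_exchange[OF p b, of \<I> \<I> \<I>, symmetric, simplified]
     layer_exchange[OF s q, of \<I> \<I> \<I>, simplified]
  show ?thesis
    unfolding cable_def yang_baxter_def
    by (rule eqI_Some) (simp add: rules rules[THEN seq_tail, simplified seq_assoc])
qed

end

section \<open>Twisted tensor products of algebras\<close>

context
  fixes A B mA mB t
  assumes o: "A \<in> Obj C" "B \<in> Obj C" and t: "t \<in> Hom C (A \<odot> B) (B \<odot> A)"
    and mA: "mA \<in> Hom C (A \<odot> A) A" and mB: "mB \<in> Hom C (B \<odot> B) B"
begin

abbreviation (input) "M \<equiv> twisted_mult B A mB mA t"
abbreviation (input) "P \<equiv> B \<odot> A"

text \<open>Both bracketings reduce to sorting the word \<open>B A B A B A\<close> into \<open>B B B A A A\<close> with \<open>t\<close> and then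
  multiplying the three \<open>B\<close> and the three \<open>A\<close>: naturality of \<open>t\<close> lets every multiplication wait until the
  sorting is finished.\<close>

lemma twisted_mult_assoc:
  assumes aA: "mA \<cdot> (mA \<otimes> Id A) = mA \<cdot> (Id A \<otimes> mA)" and aB: "mB \<cdot> (mB \<otimes> Id B) = mB \<cdot> (Id B \<otimes> mB)"
    and tA: "t \<cdot> (mA \<otimes> Id B) = (Id B \<otimes> mA) \<cdot> (t \<otimes> Id A) \<cdot> (Id A \<otimes> t)"
    and tB: "t \<cdot> (Id A \<otimes> mB) = (mB \<otimes> Id A) \<cdot> (Id B \<otimes> t) \<cdot> (t \<otimes> Id B)"
  shows "M \<cdot> (M \<otimes> Id P) = M \<cdot> (Id P \<otimes> M)"
proof -
  note [simp] = layer_simps o hom_type_Hom[OF t] hom_type_Hom[OF mA] hom_type_Hom[OF mB]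
  note rules = layer_cong[OF aB, of \<I> A, simplified]
     layer_cong[OF aA, of "B \<odot> B \<odot> B" \<I>, simplified]
     layer_cong[OF tA, of "B\<odot>B" A, simplified]
     layer_cong[OF tB, of B A, simplified]
     layer_exchange[OF mB t, of \<I> A \<I>, symmetric, simplified]
     layer_exchange[OF mB mA, of \<I> \<I> B, symmetric, simplified]
     layer_exchange[OF mB mA, of B \<I> \<I>, symmetric, simplified]
     layer_exchange[OF t mA, of "B\<odot>B" \<I> \<I>, symmetric, simplified]
     layer_exchange[OF t mA, of "B" \<I> B, symmetric, simplified]
     layer_exchange[OF t t, of B A \<I>, symmetric, simplified]
  show ?thesis
    unfolding twisted_mult_def
    by (rule eqI_Some) (simp add: rules rules[THEN seq_tail, simplified seq_assoc])
qed

context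
  fixes nA nB
  assumes nA: "nA \<in> Hom C \<I> A" and nB: "nB \<in> Hom C \<I> B"
    and unA: "mA \<cdot> (nA \<otimes> Id A) = Id A" "mA \<cdot> (Id A \<otimes> nA) = Id A"
    and unB: "mB \<cdot> (nB \<otimes> Id B) = Id B" "mB \<cdot> (Id B \<otimes> nB) = Id B"
    and tnA: "t \<cdot> (nA \<otimes> Id B) = Id B \<otimes> nA"
    and tnB: "t \<cdot> (Id A \<otimes> nB) = nB \<otimes> Id A"
begin

lemma twisted_mult_unit:
  "M \<cdot> ((nB \<otimes> nA) \<otimes> Id P) = Id P" "M \<cdot> (Id P \<otimes> (nB \<otimes> nA)) = Id P"
proof -
  note [simp] = layer_simps o hom_type_Hom[OF t] hom_type_Hom[OF mA] hom_type_Hom[OF mB]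
    hom_type_Hom[OF nA] hom_type_Hom[OF nB]
  note rules = layer_cong[OF unA(1), of B \<I>, simplified] layer_cong[OF unA(2), of B \<I>, simplified]
     layer_cong[OF unB(1), of \<I> A, simplified] layer_cong[OF unB(2), of \<I> A, simplified]
     layer_cong[OF tnA, of "\<I>" A, simplified] layer_cong[OF tnB, of B A, simplified]
     layer_exchange[OF nB t, of \<I> A \<I>, symmetric, simplified]
     layer_exchange[OF nB mA, of \<I> \<I> B, symmetric, simplified]
     layer_exchange[OF nB mA, of B \<I> \<I>, symmetric, simplified]
  show "M \<cdot> ((nB \<otimes> nA) \<otimes> Id P) = Id P" "M \<cdot> (Id P \<otimes> (nB \<otimes> nA)) = Id P"
    unfolding twisted_mult_def
    by (rule eqI_Some, (simp add: rules rules[THEN seq_tail, simplified seq_assoc]; fail))+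
qed

text \<open>Multiplication by an element of one of the factors. These four formulas determine all products that
  the converse of associativity needs.\<close>

lemma twisted_mult_factors:
  "M \<cdot> (Id P \<otimes> nB \<otimes> Id A) = Id B \<otimes> mA"
  "M \<cdot> (Id B \<otimes> nA \<otimes> Id P) = mB \<otimes> Id A"
  "M \<cdot> (nB \<otimes> Id A \<otimes> Id P) = (Id B \<otimes> mA) \<cdot> (t \<otimes> Id A)"
  "M \<cdot> (Id P \<otimes> Id B \<otimes> nA) = (mB \<otimes> Id A) \<cdot> (Id B \<otimes> t)"
proof -
  note [simp] = layer_simps o hom_type_Hom[OF t] hom_type_Hom[OF mA] hom_type_Hom[OF mB]
    hom_type_Hom[OF nA] hom_type_Hom[OF nB]
  note rules = layer_cong[OF unA(1), of "B\<odot>B" \<I>, simplified] layer_cong[OF unA(2), of "B\<odot>B" \<I>, simplified]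
     layer_cong[OF unB(1), of \<I> A, simplified] layer_cong[OF unB(2), of \<I> A, simplified]
     layer_cong[OF tnA, of B A, simplified] layer_cong[OF tnB, of B A, simplified]
     layer_exchange[OF nB t, of \<I> A \<I>, symmetric, simplified]
     layer_exchange[OF nB mA, of \<I> \<I> B, symmetric, simplified]
     layer_exchange[OF nB mA, of B \<I> \<I>, symmetric, simplified]
     layer_exchange[OF t nA, of B \<I> \<I>, simplified]
  show "M \<cdot> (Id P \<otimes> nB \<otimes> Id A) = Id B \<otimes> mA"
  "M \<cdot> (Id B \<otimes> nA \<otimes> Id P) = mB \<otimes> Id A"
  "M \<cdot> (nB \<otimes> Id A \<otimes> Id P) = (Id B \<otimes> mA) \<cdot> (t \<otimes> Id A)"
  "M \<cdot> (Id P \<otimes> Id B \<otimes> nA) = (mB \<otimes> Id A) \<cdot> (Id B \<otimes> t)"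
    unfolding twisted_mult_def
    by (rule eqI_Some, (simp add: rules rules[THEN seq_tail, simplified seq_assoc]; fail))+
qed

text \<open>The embeddings of the two factors into \<open>B \<odot> A\<close>.\<close>

abbreviation (input) "iA \<equiv> nB \<otimes> Id A"
abbreviation (input) "iB \<equiv> Id B \<otimes> nA"

text \<open>Both factors are subalgebras, and \<open>t\<close> can be recovered from the product, as the product of \<open>A\<close> and \<open>B\<close>
  in the order opposite to that of \<open>B \<odot> A\<close>.\<close>

lemma twisted_mult_inclusions:
  "M \<cdot> (iA \<otimes> iA) = iA \<cdot> mA"
  "M \<cdot> (iB \<otimes> iB) = iB \<cdot> mB"
  "M \<cdot> (iA \<otimes> iB) = t"
  "M \<cdot> (iB \<otimes> iA) = Id P"
proof -
  note [simp] = layer_simps o hom_type_Hom[OF t] hom_type_Hom[OF mA] hom_type_Hom[OF mB]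
    hom_type_Hom[OF nA] hom_type_Hom[OF nB] hom_type_Hom[OF twisted_mult_Hom[OF mB mA t o]]
  note rules = twisted_mult_factors[THEN layer_cong, of \<I> \<I>, simplified]
     layer_cong[OF tnB, of \<I> A, simplified] layer_cong[OF unA(2), of B \<I>, simplified]
     layer_cong[OF unB(2), of \<I> A, simplified]
     layer_exchange[OF t nA, of \<I> \<I> \<I>, simplified]
     layer_exchange[OF nB mA, of \<I> \<I> \<I>, symmetric, simplified]
     layer_exchange[OF mB nA, of \<I> \<I> \<I>, simplified]
  show "M \<cdot> (iA \<otimes> iA) = iA \<cdot> mA"
    by (rule eqI_Some) (simp add: rules rules[THEN seq_tail, simplified seq_assoc])
  show "M \<cdot> (iB \<otimes> iB) = iB \<cdot> mB"
    by (rule eqI_Some) (simp add: rules rules[THEN seq_tail, simplified seq_assoc])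
  show "M \<cdot> (iA \<otimes> iB) = t"
    by (rule eqI_Some) (simp add: rules rules[THEN seq_tail, simplified seq_assoc])
  show "M \<cdot> (iB \<otimes> iA) = Id P"
    by (rule eqI_Some) (simp add: rules rules[THEN seq_tail, simplified seq_assoc])
qed

context
  assumes assoc: "M \<cdot> (M \<otimes> Id P) = M \<cdot> (Id P \<otimes> M)"
begin

text \<open>Associativity on \<open>A A A\<close>, \<open>A A B\<close> and \<open>A B B\<close>, embedded by \<open>iA\<close> and \<open>iB\<close>, gives the three equations in turn.
  The first one is associativity of \<open>mA\<close> up to the embedding \<open>iA\<close>, which need not be
  cancellable here.\<close>

lemma twisted_mult_assoc_imp:
 "nB \<otimes> (mA \<cdot> (mA \<otimes> Id A)) = nB \<otimes> (mA \<cdot> (Id A \<otimes> mA))"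
 "t \<cdot> (mA \<otimes> Id B) = (Id B \<otimes> mA) \<cdot> (t \<otimes> Id A) \<cdot> (Id A \<otimes> t)"
 "t \<cdot> (Id A \<otimes> mB) = (mB \<otimes> Id A) \<cdot> (Id B \<otimes> t) \<cdot> (t \<otimes> Id B)"
proof -
  note Mh = twisted_mult_Hom[OF mB mA t o]
  note [simp] = layer_simps o hom_type_Hom[OF t] hom_type_Hom[OF mA] hom_type_Hom[OF mB]
    hom_type_Hom[OF nA] hom_type_Hom[OF nB] hom_type_Hom[OF twisted_mult_Hom[OF mB mA t o]]
  note rules = twisted_mult_factors[THEN layer_cong, of \<I> \<I>, simplified]
     twisted_mult_factors[THEN layer_cong, of \<I> P, simplified]
     twisted_mult_factors[THEN layer_cong, of A \<I>, simplified]
     layer_cong[OF tnB, of \<I> A, simplified]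
     layer_cong[OF tnB, of A A, simplified]
     layer_cong[OF tnB, of \<I> "A \<odot> P", simplified]
     layer_cong[OF unA(2), of B \<I>, simplified] layer_cong[OF unA(2), of "A\<odot>B" \<I>, simplified]
     layer_cong[OF unA(2), of B P, simplified]
     layer_exchange[OF mA nB, of \<I> A \<I>, simplified]
     layer_exchange[OF nB Mh, of \<I> \<I> A, symmetric, simplified]
     layer_exchange[OF nB mA, of \<I> \<I> \<I>, symmetric, simplified]
     layer_exchange[OF nB mA, of \<I> P \<I>, symmetric, simplified]
     layer_exchange[OF nB mA, of A \<I> \<I>, symmetric, simplified]
     layer_exchange[OF t nA, of \<I> \<I> \<I>, simplified]
     layer_exchange[OF t nA, of \<I> P \<I>, simplified]
     layer_exchange[OF t nA, of A \<I> \<I>, simplified]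
     layer_exchange[OF t nA, of \<I> \<I> B, simplified]
     layer_exchange[OF mA nA, of \<I> \<I> B, simplified]
     layer_exchange[OF mB nA, of A \<I> \<I>, simplified]
  \<comment> \<open>Associativity precomposed with an arbitrary morphism, to be instantiated with embeddings of three factors.\<close>
  have E: "Some (M \<cdot> (M \<otimes> Id P)) \<star> Some K = Some (M \<cdot> (Id P \<otimes> M)) \<star> Some K" for K
    by (simp only: assoc)
  show "nB \<otimes> (mA \<cdot> (mA \<otimes> Id A)) = nB \<otimes> (mA \<cdot> (Id A \<otimes> mA))"
    using E[of "iA \<otimes> iA \<otimes> iA"]
    by - (rule eqI_Some, simp add: rules rules[THEN seq_tail, simplified seq_assoc])
  show "t \<cdot> (mA \<otimes> Id B) = (Id B \<otimes> mA) \<cdot> (t \<otimes> Id A) \<cdot> (Id A \<otimes> t)"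
    using E[of "iA \<otimes> iA \<otimes> iB"]
    by - (rule eqI_Some, simp add: rules rules[THEN seq_tail, simplified seq_assoc])
  show "t \<cdot> (Id A \<otimes> mB) = (mB \<otimes> Id A) \<cdot> (Id B \<otimes> t) \<cdot> (t \<otimes> Id B)"
    using E[of "iA \<otimes> iB \<otimes> iB"]
    by - (rule eqI_Some, simp add: rules rules[THEN seq_tail, simplified seq_assoc])
qed

end

end

end

section \<open>Restriction along split monomorphisms\<close>

text \<open>Split rather than arbitrary monomorphisms are used because splitting survives tensoring.\<close>

definition split_mono :: "'m \<Rightarrow> 'o \<Rightarrow> 'o \<Rightarrow> bool" where
  "split_mono f a b \<longleftrightarrow> f \<in> Hom C a b \<and> (\<exists>p \<in> Hom C b a. p \<cdot> f = Id a)"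

lemma split_mono_id: "a \<in> Obj C \<Longrightarrow> split_mono (Id a) a a"
  unfolding split_mono_def using id_hom comp_id_left by blast

lemma split_mono_tens:
  assumes "split_mono f a b" "split_mono g c d"
  shows "split_mono (f \<otimes> g) (a \<odot> c) (b \<odot> d)"
proof -
  obtain p q where h: "f \<in> Hom C a b" "g \<in> Hom C c d" "p \<in> Hom C b a" "q \<in> Hom C d c"
    "p \<cdot> f = Id a" "q \<cdot> g = Id c"
    using assms unfolding split_mono_def by blast
  have "(p \<otimes> q) \<cdot> (f \<otimes> g) = Id (a \<odot> c)"
    using mtens_comp[OF h(1,3,2,4)] HomD[OF h(1)] HomD[OF h(2)] by (simp add: h(5,6) mtens_id)
  then show ?thesis
    unfolding split_mono_def using mtens_hom[OF h(1,2)] mtens_hom[OF h(3,4)] by blast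
qed

lemma split_mono_comp:
  assumes "split_mono f a b" "split_mono g b c"
  shows "split_mono (g \<cdot> f) a c"
proof -
  obtain p q where h: "f \<in> Hom C a b" "g \<in> Hom C b c" "p \<in> Hom C b a" "q \<in> Hom C c b"
    "p \<cdot> f = Id a" "q \<cdot> g = Id b"
    using assms unfolding split_mono_def by blast
  have "(p \<cdot> q) \<cdot> (g \<cdot> f) = p \<cdot> ((q \<cdot> g) \<cdot> f)"
    using HomD[OF h(1)] HomD[OF h(2)] HomD[OF h(3)] HomD[OF h(4)] by (simp add: comp_rules comp_simps)
  also have "\<dots> = Id a" using HomD[OF h(1)] by (simp add: h(5,6) comp_rules)
  finally show ?thesis
    unfolding split_mono_def using comp_hom[OF h(1,2)] comp_hom[OF h(4,3)] by blast
qed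

lemma unit_tensor_cancel:
  assumes "n \<in> Hom C \<I> V" "e \<in> Hom C V \<I>" "e \<cdot> n = Id \<I>" "f \<in> Hom C a b" "g \<in> Hom C a b"
   and eq: "n \<otimes> f = n \<otimes> g"
  shows "f = g"
proof -
  note o [simp] = HomD(4,5)[OF assms(1)] HomD(4,5)[OF assms(4)]
  note [simp] = layer_simps assms(1,2,4,5)[THEN hom_type_Hom]
  note rules = layer_cong[OF assms(3), of \<I> b, simplified]
  have "Some (e \<otimes> Id b) \<star> Some (n \<otimes> f) = Some (e \<otimes> Id b) \<star> Some (n \<otimes> g)" by (simp only: eq)
  then show ?thesis by (simp add: rules rules[THEN seq_tail, simplified seq_assoc])
qed

text \<open>The equation for \<open>b\<close>, precomposed with the inclusion \<open>i\<close>, is the equation for \<open>s\<close> followed by \<open>i\<close>; the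
  retraction \<open>p\<close> removes it.\<close>

lemma natural_snd_mult_restrict:
  assumes o: "A \<in> Obj C" "W \<in> Obj C" "X \<in> Obj C"
   and b: "b \<in> Hom C (A \<odot> W) (W \<odot> A)" and s: "s \<in> Hom C (X \<odot> W) (W \<odot> X)"
   and i: "i \<in> Hom C X A" and p: "p \<in> Hom C A X" and ret: "p \<cdot> i = Id X"
   and bi: "b \<cdot> (i \<otimes> Id W) = (Id W \<otimes> i) \<cdot> s"
   and m: "m \<in> Hom C (W \<odot> W) W"
   and nat: "b \<cdot> (Id A \<otimes> m) = (m \<otimes> Id A) \<cdot> (Id W \<otimes> b) \<cdot> (b \<otimes> Id W)"
  shows "s \<cdot> (Id X \<otimes> m) = (m \<otimes> Id X) \<cdot> (Id W \<otimes> s) \<cdot> (s \<otimes> Id W)"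
proof -
  note [simp] = layer_simps o m[THEN hom_type_Hom] b[THEN hom_type_Hom] s[THEN hom_type_Hom] i[THEN hom_type_Hom] p[THEN hom_type_Hom]
  note rules = layer_cong[OF ret, of W \<I>, simplified]
     layer_cong[OF bi, of \<I> \<I>, simplified] layer_cong[OF bi, of W \<I>, simplified] layer_cong[OF bi, of \<I> W, simplified]
     layer_exchange[OF i m, of \<I> \<I> \<I>, symmetric, simplified]
     layer_exchange[OF m i, of \<I> \<I> \<I>, simplified]
  \<comment> \<open>The outer factor \<open>p\<close> is there to cancel the \<open>i\<close> that the inner factor \<open>i\<close> turns into.\<close>
  have "Some (Id W \<otimes> p) \<star> Some (b \<cdot> (Id A \<otimes> m)) \<star> Some (i \<otimes> Id (W \<odot> W))
    = Some (Id W \<otimes> p) \<star> Some ((m \<otimes> Id A) \<cdot> (Id W \<otimes> b) \<cdot> (b \<otimes> Id W)) \<star> Some (i \<otimes> Id (W \<odot> W))"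
    by (simp only: nat)
  then show ?thesis
    by - (rule eqI_Some, simp add: rules rules[THEN seq_tail, simplified seq_assoc])
qed

text \<open>The product of \<open>X\<close> and \<open>Y\<close> inside \<open>A\<close> is moved past \<open>W\<close> one factor at a time.
  Comparing the two orders of the factors is what yields the Yang-Baxter equation below.\<close>

lemma natural_fst_product:
  assumes o: "A \<in> Obj C" "W \<in> Obj C" "X \<in> Obj C" "Y \<in> Obj C"
   and b: "b \<in> Hom C (A \<odot> W) (W \<odot> A)" and s: "s \<in> Hom C (X \<odot> W) (W \<odot> X)"
   and s': "s' \<in> Hom C (Y \<odot> W) (W \<odot> Y)"
   and i: "i \<in> Hom C X A" and j: "j \<in> Hom C Y A" and m: "m \<in> Hom C (A \<odot> A) A"
   and bi: "b \<cdot> (i \<otimes> Id W) = (Id W \<otimes> i) \<cdot> s"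
   and bj: "b \<cdot> (j \<otimes> Id W) = (Id W \<otimes> j) \<cdot> s'"
   and nat: "b \<cdot> (m \<otimes> Id W) = (Id W \<otimes> m) \<cdot> (b \<otimes> Id A) \<cdot> (Id A \<otimes> b)"
  shows "b \<cdot> ((m \<cdot> (i \<otimes> j)) \<otimes> Id W) = (Id W \<otimes> (m \<cdot> (i \<otimes> j))) \<cdot> (s \<otimes> Id Y) \<cdot> (Id X \<otimes> s')"
proof -
  note [simp] = layer_simps o m[THEN hom_type_Hom] b[THEN hom_type_Hom] s[THEN hom_type_Hom]
    s'[THEN hom_type_Hom] i[THEN hom_type_Hom] j[THEN hom_type_Hom]
  note rules = layer_cong[OF nat, of \<I> \<I>, simplified]
     layer_cong[OF bi, of \<I> A, simplified] layer_cong[OF bj, of X \<I>, simplified]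
     layer_exchange[OF i b, of \<I> \<I> \<I>, symmetric, simplified]
     layer_exchange[OF s j, of \<I> \<I> \<I>, simplified]
  show ?thesis
    by (rule eqI_Some) (simp add: rules rules[THEN seq_tail, simplified seq_assoc])
qed

lemma natural_fst_mult_restrict:
  assumes o: "A \<in> Obj C" "W \<in> Obj C" "X \<in> Obj C"
   and b: "b \<in> Hom C (A \<odot> W) (W \<odot> A)" and s: "s \<in> Hom C (X \<odot> W) (W \<odot> X)"
   and i: "i \<in> Hom C X A" and p: "p \<in> Hom C A X" and ret: "p \<cdot> i = Id X"
   and bi: "b \<cdot> (i \<otimes> Id W) = (Id W \<otimes> i) \<cdot> s"
   and m: "m \<in> Hom C (A \<odot> A) A" and k: "k \<in> Hom C (X \<odot> X) X" and mi: "m \<cdot> (i \<otimes> i) = i \<cdot> k"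
   and nat: "b \<cdot> (m \<otimes> Id W) = (Id W \<otimes> m) \<cdot> (b \<otimes> Id A) \<cdot> (Id A \<otimes> b)"
  shows "s \<cdot> (k \<otimes> Id W) = (Id W \<otimes> k) \<cdot> (s \<otimes> Id X) \<cdot> (Id X \<otimes> s)"
proof -
  note [simp] = layer_simps o k[THEN hom_type_Hom] b[THEN hom_type_Hom] s[THEN hom_type_Hom] i[THEN hom_type_Hom] p[THEN hom_type_Hom]
  note rules = layer_cong[OF ret, of W \<I>, simplified]
     layer_cong[OF bi, of \<I> \<I>, simplified]
  have "Some (Id W \<otimes> p) \<star> Some (b \<cdot> ((i \<cdot> k) \<otimes> Id W))
    = Some (Id W \<otimes> p) \<star> Some ((Id W \<otimes> (i \<cdot> k)) \<cdot> (s \<otimes> Id X) \<cdot> (Id X \<otimes> s))"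
    using natural_fst_product[OF o o(3) b s s i i m bi bi nat] by (simp only: mi)
  then show ?thesis
    by - (rule eqI_Some, simp add: rules rules[THEN seq_tail, simplified seq_assoc])
qed

text \<open>The product of \<open>X\<close> and \<open>Y\<close> in \<open>A\<close> equals the product in the opposite order after \<open>x\<close>. Moving it past \<open>W\<close> before
  or after this rewriting gives the two sides of the Yang-Baxter equation, followed by the split
  monomorphism \<open>m \<cdot> (j \<otimes> i)\<close>.\<close>

lemma yang_baxter_restrict:
  assumes o: "A \<in> Obj C" "W \<in> Obj C" "X \<in> Obj C" "Y \<in> Obj C"
   and b: "b \<in> Hom C (A \<odot> W) (W \<odot> A)" and s: "s \<in> Hom C (X \<odot> W) (W \<odot> X)"
   and s': "s' \<in> Hom C (Y \<odot> W) (W \<odot> Y)" and x: "x \<in> Hom C (X \<odot> Y) (Y \<odot> X)"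
   and i: "i \<in> Hom C X A" and j: "j \<in> Hom C Y A" and m: "m \<in> Hom C (A \<odot> A) A"
   and bi: "b \<cdot> (i \<otimes> Id W) = (Id W \<otimes> i) \<cdot> s"
   and bj: "b \<cdot> (j \<otimes> Id W) = (Id W \<otimes> j) \<cdot> s'"
   and nat: "b \<cdot> (m \<otimes> Id W) = (Id W \<otimes> m) \<cdot> (b \<otimes> Id A) \<cdot> (Id A \<otimes> b)"
   and swap: "m \<cdot> (i \<otimes> j) = (m \<cdot> (j \<otimes> i)) \<cdot> x"
   and p: "p \<in> Hom C A (Y \<odot> X)" and ret: "p \<cdot> (m \<cdot> (j \<otimes> i)) = Id (Y \<odot> X)"
  shows "yang_baxter X Y W x s s'"
proof -
  define k where "k = m \<cdot> (j \<otimes> i)"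
  have k: "k \<in> Hom C (Y \<odot> X) A"
    using comp_hom[OF mtens_hom[OF j i] m] by (simp add: k_def)
  note [simp] = layer_simps o k[THEN hom_type_Hom] b[THEN hom_type_Hom] s[THEN hom_type_Hom]
   s'[THEN hom_type_Hom] x[THEN hom_type_Hom] p[THEN hom_type_Hom]
  have 1: "b \<cdot> ((k \<cdot> x) \<otimes> Id W) = (Id W \<otimes> (k \<cdot> x)) \<cdot> (s \<otimes> Id Y) \<cdot> (Id X \<otimes> s')"
    using natural_fst_product[OF o b s s' i j m bi bj nat] by (simp only: swap k_def)
  have 2: "b \<cdot> (k \<otimes> Id W) = (Id W \<otimes> k) \<cdot> (s' \<otimes> Id X) \<cdot> (Id Y \<otimes> s)"
    using natural_fst_product[OF o(1,2,4,3) b s' s j i m bj bi nat] by (simp only: k_def)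
  note rules = layer_cong[OF ret[folded k_def], of W \<I>, simplified] layer_cong[OF 2, of \<I> \<I>, simplified]
  have "Some (Id W \<otimes> p) \<star> Some (b \<cdot> ((k \<cdot> x) \<otimes> Id W))
   = Some (Id W \<otimes> p) \<star> Some ((Id W \<otimes> (k \<cdot> x)) \<cdot> (s \<otimes> Id Y) \<cdot> (Id X \<otimes> s'))"
    by (simp only: 1)
  then show ?thesis unfolding yang_baxter_def
    by - (rule eqI_Some, simp add: rules rules[THEN seq_tail, simplified seq_assoc])
qed

section \<open>The braiding of an algebra\<close>

lemma sigma_Ass_Hom:
  assumes "V \<in> Obj C" "m \<in> Hom C (V \<odot> V) V" "n \<in> Hom C \<I> V"
  shows "sigma_Ass C m n \<in> Hom C (V \<odot> V) (V \<odot> V)"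
  using mtens_hom[OF assms(3,2)] assms(1) by (simp add: sigma_Ass_def object_simps)

text \<open>In elements, the morphism sends \<open>a, b\<close> to \<open>1, ab\<close>, and both sides send \<open>a, b, c\<close> to \<open>1, 1, abc\<close>.\<close>

lemma yang_baxter_sigma_Ass:
  assumes o: "V \<in> Obj C" and m: "m \<in> Hom C (V \<odot> V) V" and n: "n \<in> Hom C \<I> V"
   and a: "m \<cdot> (m \<otimes> Id V) = m \<cdot> (Id V \<otimes> m)" and u: "m \<cdot> (n \<otimes> Id V) = Id V"
  shows "yang_baxter V V V (sigma_Ass C m n) (sigma_Ass C m n) (sigma_Ass C m n)"
proof -
  note [simp] = layer_simps o m[THEN hom_type_Hom] n[THEN hom_type_Hom]
  note rules = layer_cong[OF a, of \<I> \<I>, simplified]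
     layer_cong[OF u, of V \<I>, simplified]
     layer_cong[OF u, of \<I> V, simplified]
    layer_exchange[OF n m, of \<I> \<I> \<I>, symmetric, simplified]
    layer_exchange[OF n n, of \<I> V \<I>, symmetric, simplified]
  show ?thesis unfolding yang_baxter_def sigma_Ass_def
    by (rule eqI_Some) (simp add: rules rules[THEN seq_tail, simplified seq_assoc])
qed

text \<open>With one of the two morphisms of the form \<open>n \<otimes> m\<close>, the two sides of the Yang-Baxter equation
  are those of the naturality equation for \<open>m\<close>, followed by insertion of the unit \<open>n\<close>. The normalization \<open>e\<close> cancels \<open>n\<close>.\<close>

context
  fixes V W x
  assumes o: "V \<in> Obj C" "W \<in> Obj C" and x: "x \<in> Hom C (V \<odot> W) (W \<odot> V)"
begin

lemma yang_baxter_sigma_Ass_fst_iff: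
  assumes m: "m \<in> Hom C (V \<odot> V) V" and n: "n \<in> Hom C \<I> V" and e: "e \<in> Hom C V \<I>"
   and en: "e \<cdot> n = Id \<I>" and nat: "x \<cdot> (n \<otimes> Id W) = Id W \<otimes> n"
  shows "yang_baxter V V W (sigma_Ass C m n) x x \<longleftrightarrow>
    x \<cdot> (m \<otimes> Id W) = (Id W \<otimes> m) \<cdot> (x \<otimes> Id V) \<cdot> (Id V \<otimes> x)"
proof -
  note [simp] = layer_simps o x[THEN hom_type_Hom] m[THEN hom_type_Hom] n[THEN hom_type_Hom] e[THEN hom_type_Hom]
  note rules = layer_cong[OF nat, of \<I> V, simplified] layer_cong[OF en, of W V, simplified]
    layer_exchange[OF n x, of \<I> \<I> \<I>, symmetric, simplified]
  note r = rules rules[THEN seq_tail, simplified seq_assoc]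
  let ?L = "Some (x \<cdot> (m \<otimes> Id W))" and ?R = "Some ((Id W \<otimes> m) \<cdot> (x \<otimes> Id V) \<cdot> (Id V \<otimes> x))"
  have L: "Some ((x \<otimes> Id V) \<cdot> (Id V \<otimes> x) \<cdot> (sigma_Ass C m n \<otimes> Id W)) = layer W (Some n) V \<star> ?L"
    unfolding sigma_Ass_def by (simp add: r)
  have R: "Some ((Id W \<otimes> sigma_Ass C m n) \<cdot> (x \<otimes> Id V) \<cdot> (Id V \<otimes> x)) = layer W (Some n) V \<star> ?R"
    unfolding sigma_Ass_def by (simp add: r)
  have cancel: "?L = ?R" if eq: "layer W (Some n) V \<star> ?L = layer W (Some n) V \<star> ?R"
  proof -
    have "(layer W (Some e) V \<star> layer W (Some n) V) \<star> ?L = (layer W (Some e) V \<star> layer W (Some n) V) \<star> ?R"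
      by (simp only: seq_assoc eq)
    then show ?thesis by (simp add: r)
  qed
  show ?thesis
  proof
    assume "yang_baxter V V W (sigma_Ass C m n) x x"
    then have "layer W (Some n) V \<star> ?L = layer W (Some n) V \<star> ?R"
      using L R by (simp only: yang_baxter_def)
    then show "x \<cdot> (m \<otimes> Id W) = (Id W \<otimes> m) \<cdot> (x \<otimes> Id V) \<cdot> (Id V \<otimes> x)" using cancel by (simp only: option.inject)
  next
    assume "x \<cdot> (m \<otimes> Id W) = (Id W \<otimes> m) \<cdot> (x \<otimes> Id V) \<cdot> (Id V \<otimes> x)"
    then show "yang_baxter V V W (sigma_Ass C m n) x x"
      unfolding yang_baxter_def by - (rule option.inject[THEN iffD1], simp only: L R)
  qed
qed

lemma yang_baxter_sigma_Ass_snd_iff: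
  assumes m: "m \<in> Hom C (W \<odot> W) W" and n: "n \<in> Hom C \<I> W" and e: "e \<in> Hom C W \<I>"
   and en: "e \<cdot> n = Id \<I>" and nat: "x \<cdot> (Id V \<otimes> n) = n \<otimes> Id V"
  shows "yang_baxter V W W x x (sigma_Ass C m n) \<longleftrightarrow>
    x \<cdot> (Id V \<otimes> m) = (m \<otimes> Id V) \<cdot> (Id W \<otimes> x) \<cdot> (x \<otimes> Id W)"
proof -
  note [simp] = layer_simps o x[THEN hom_type_Hom] m[THEN hom_type_Hom] n[THEN hom_type_Hom] e[THEN hom_type_Hom]
  note rules = layer_cong[OF nat, of \<I> W, simplified] layer_cong[OF en, of \<I> "W \<odot> V", simplified]
    layer_exchange[OF n x, of \<I> \<I> \<I>, symmetric, simplified]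
  note r = rules rules[THEN seq_tail, simplified seq_assoc]
  let ?L = "Some (x \<cdot> (Id V \<otimes> m))" and ?R = "Some ((m \<otimes> Id V) \<cdot> (Id W \<otimes> x) \<cdot> (x \<otimes> Id W))"
  have L: "Some ((Id W \<otimes> x) \<cdot> (x \<otimes> Id W) \<cdot> (Id V \<otimes> sigma_Ass C m n)) = layer \<I> (Some n) (W \<odot> V) \<star> ?L"
    unfolding sigma_Ass_def by (simp add: r)
  have R: "Some ((sigma_Ass C m n \<otimes> Id V) \<cdot> (Id W \<otimes> x) \<cdot> (x \<otimes> Id W)) = layer \<I> (Some n) (W \<odot> V) \<star> ?R"
    unfolding sigma_Ass_def by (simp add: r)
  have cancel: "?L = ?R" if eq: "layer \<I> (Some n) (W \<odot> V) \<star> ?L = layer \<I> (Some n) (W \<odot> V) \<star> ?R"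
  proof -
    have "(layer \<I> (Some e) (W \<odot> V) \<star> layer \<I> (Some n) (W \<odot> V)) \<star> ?L = (layer \<I> (Some e) (W \<odot> V) \<star> layer \<I> (Some n) (W \<odot> V)) \<star> ?R"
      by (simp only: seq_assoc eq)
    then show ?thesis by (simp add: r)
  qed
  show ?thesis
  proof
    assume "yang_baxter V W W x x (sigma_Ass C m n)"
    then have "layer \<I> (Some n) (W \<odot> V) \<star> ?L = layer \<I> (Some n) (W \<odot> V) \<star> ?R"
      using L R by (simp only: yang_baxter_def)
    then show "x \<cdot> (Id V \<otimes> m) = (m \<otimes> Id V) \<cdot> (Id W \<otimes> x) \<cdot> (x \<otimes> Id W)" using cancel by (simp only: option.inject)
  next
    assume "x \<cdot> (Id V \<otimes> m) = (m \<otimes> Id V) \<cdot> (Id W \<otimes> x) \<cdot> (x \<otimes> Id W)"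
    then show "yang_baxter V W W x x (sigma_Ass C m n)"
      unfolding yang_baxter_def by - (rule option.inject[THEN iffD1], simp only: L R)
  qed
qed

end

section \<open>Braids acting on words\<close>

lemma otens_list_obj: "set ws \<subseteq> Obj C \<Longrightarrow> otens_list C ws \<in> Obj C"
  by (induction ws) (simp_all add: otens_list_simps object_simps)

lemma otens_list_append:
  "set us \<subseteq> Obj C \<Longrightarrow> set vs \<subseteq> Obj C \<Longrightarrow>
     otens_list C (us @ vs) = otens_list C us \<odot> otens_list C vs"
  by (induction us) (simp_all add: otens_list_simps object_simps otens_list_obj)

text \<open>The word reached from \<open>ws\<close>; this is the iteration of swaps inside \<open>braid_comp\<close>.\<close>

abbreviation permute :: "('m \<times> nat) list \<Rightarrow> 'o list \<Rightarrow> 'o list" where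
  "permute xs ws \<equiv> foldr (\<lambda>y. swap_at (snd y)) xs ws"

text \<open>Each step has to be a morphism between the two letters found at its position at that moment. Splitting the
  word there makes the position arithmetic disappear from the proofs.\<close>

primrec admissible :: "('m \<times> nat) list \<Rightarrow> 'o list \<Rightarrow> bool" where
  "admissible [] ws \<longleftrightarrow> True"
| "admissible (x # xs) ws \<longleftrightarrow> admissible xs ws \<and>
     (\<exists>a u v b. permute xs ws = a @ [u, v] @ b \<and> snd x = Suc (length a) \<and> fst x \<in> Hom C (u \<odot> v) (v \<odot> u))"

lemma swap_at_word: "swap_at (Suc (length a)) (a @ u # v # b) = a @ v # u # b"
  by (simp add: swap_at_def nth_append)

lemma act_at_word: "act_at C f 2 (Suc (length a)) (a @ u # v # b)
    = Id (otens_list C a) \<otimes> f \<otimes> Id (otens_list C b)"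
  by (simp add: act_at_def)

lemma act_at_Hom:
  assumes "set (a @ u # v # b) \<subseteq> Obj C" "f \<in> Hom C (u \<odot> v) (v \<odot> u)"
  shows "act_at C f 2 (Suc (length a)) (a @ u # v # b)
    \<in> Hom C (otens_list C (a @ u # v # b)) (otens_list C (a @ v # u # b))"
  using assms mtens_hom[OF id_hom[of "otens_list C a"] mtens_hom[OF assms(2) id_hom[of "otens_list C b"]]]
  by (simp add: act_at_word otens_list_append otens_list_simps object_simps otens_list_obj)

lemma permute_set: "admissible xs ws \<Longrightarrow> set (permute xs ws) = set ws"
  by (induction xs) (force simp: swap_at_word)+

lemma braid_comp_Hom:
  assumes "set ws \<subseteq> Obj C"
  shows "admissible xs ws \<Longrightarrow>
    braid_comp C xs ws \<in> Hom C (otens_list C ws) (otens_list C (permute xs ws))"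
proof (induction xs)
  case Nil
  then show ?case by (simp add: id_hom otens_list_obj assms)
next
  case (Cons x xs)
  then obtain a u v b where w: "permute xs ws = a @ u # v # b" "snd x = Suc (length a)"
    "fst x \<in> Hom C (u \<odot> v) (v \<odot> u)" by auto
  have "set (a @ u # v # b) \<subseteq> Obj C"
    using permute_set[of xs ws] Cons.prems assms w(1) by simp
  from comp_hom[OF _ act_at_Hom[OF this w(3)]] show ?case
    using Cons by (simp add: w swap_at_word)
qed

lemma admissible_append:
  "admissible (xs @ ys) ws \<longleftrightarrow> admissible ys ws \<and> admissible xs (permute ys ws)"
  by (induction xs) auto

lemma braid_comp_append:
  assumes "set ws \<subseteq> Obj C" "admissible ys ws"
  shows "admissible xs (permute ys ws) \<Longrightarrow>
     braid_comp C (xs @ ys) ws = braid_comp C xs (permute ys ws) \<cdot> braid_comp C ys ws"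
proof (induction xs)
  case Nil
  then show ?case using comp_id_left[OF braid_comp_Hom[OF assms]] by simp
next
  case (Cons x xs)
  let ?ws = "permute ys ws"
  have s: "set ?ws \<subseteq> Obj C" using permute_set[OF assms(2)] assms(1) by simp
  obtain a u v b where w: "permute xs ?ws = a @ u # v # b" "snd x = Suc (length a)"
    "fst x \<in> Hom C (u \<odot> v) (v \<odot> u)" using Cons.prems by auto
  have abs: "set (a @ u # v # b) \<subseteq> Obj C"
    using permute_set[of xs ?ws] Cons.prems s w(1) by simp
  have "admissible xs ?ws" using Cons.prems by simp
  from braid_comp_Hom[OF s this] have "braid_comp C xs ?ws \<in> Hom C (otens_list C ?ws) (otens_list C (a @ u # v # b))"
    unfolding w(1) .
  from comp_assoc[OF braid_comp_Hom[OF assms] this act_at_Hom[OF abs w(3)]]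
  show ?case using Cons by (simp add: w)
qed

text \<open>Braids acting inside a longer word, after a prefix of length \<open>k\<close>.\<close>

definition shift :: "nat \<Rightarrow> ('m \<times> nat) list \<Rightarrow> ('m \<times> nat) list" where
  "shift k xs = map (\<lambda>x. (fst x, k + snd x)) xs"

lemma shift_simps [simp]: "shift k [] = []" "shift k (x # xs) = (fst x, k + snd x) # shift k xs"
  by (simp_all add: shift_def)

lemma shift_word:
  assumes "set us \<subseteq> Obj C" "set ws \<subseteq> Obj C" "set vs \<subseteq> Obj C"
  shows "admissible xs ws \<Longrightarrow> admissible (shift (length us) xs) (us @ ws @ vs)
    \<and> permute (shift (length us) xs) (us @ ws @ vs) = us @ permute xs ws @ vs
    \<and> braid_comp C (shift (length us) xs) (us @ ws @ vs)
      = Id (otens_list C us) \<otimes> braid_comp C xs ws \<otimes> Id (otens_list C vs)"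
proof (induction xs)
  case Nil
  then show ?case using assms
    by (simp add: otens_list_append otens_list_obj mtens_id otens_obj)
next
  case (Cons x xs)
  then obtain a u v b where w: "permute xs ws = a @ u # v # b" "snd x = Suc (length a)"
    "fst x \<in> Hom C (u \<odot> v) (v \<odot> u)" by auto
  have s: "set (a @ u # v # b) \<subseteq> Obj C"
    using permute_set[of xs ws] Cons.prems assms w(1) by simp
  have IH: "admissible (shift (length us) xs) (us @ ws @ vs)"
    "permute (shift (length us) xs) (us @ ws @ vs) = us @ a @ u # v # b @ vs"
    "braid_comp C (shift (length us) xs) (us @ ws @ vs)
      = Id (otens_list C us) \<otimes> braid_comp C xs ws \<otimes> Id (otens_list C vs)"
    using Cons w(1) by auto
  note o = otens_list_obj[OF assms(1)] otens_list_obj[OF assms(3)] otens_list_obj[of a] otens_list_obj[of b]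
  have h: "braid_comp C xs ws \<in> Hom C (otens_list C ws) (otens_list C (a @ u # v # b))"
    using braid_comp_Hom[OF assms(2), of xs] Cons.prems w(1) by simp
  note h' = HomD[OF h] HomD[OF w(3)] HomD[OF act_at_Hom[OF s w(3)]]
  have act: "act_at C (fst x) 2 (Suc (length (us @ a))) ((us @ a) @ u # v # (b @ vs))
    = Id (otens_list C us) \<otimes> act_at C (fst x) 2 (Suc (length a)) (a @ u # v # b) \<otimes> Id (otens_list C vs)"
    using s o assms h' unfolding act_at_word
    by (simp add: otens_list_append mtens_id[symmetric] mtens_assoc id_simps tens_simps)
  have "act_at C (fst x) 2 (Suc (length (us @ a))) ((us @ a) @ u # v # (b @ vs))
     \<cdot> braid_comp C (shift (length us) xs) (us @ ws @ vs)
    = Id (otens_list C us) \<otimes> (act_at C (fst x) 2 (Suc (length a)) (a @ u # v # b) \<cdot> braid_comp C xs ws)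
        \<otimes> Id (otens_list C vs)"
    unfolding act IH(3) using h' o by (simp add: interchange tens_simps id_simps comp_simps comp_rules)
  moreover have "permute (shift (length us) (x # xs)) (us @ ws @ vs) = us @ permute (x # xs) ws @ vs"
    using swap_at_word[of "us @ a" u v "b @ vs"] swap_at_word[of a u v b]
    by (simp add: IH(2) w)
  moreover have "admissible (shift (length us) (x # xs)) (us @ ws @ vs)"
    using IH(1,2) w(2,3)
    by (simp, intro exI[of _ "us @ a"] exI[of _ u] exI[of _ v] exI[of _ "b @ vs"]) simp
  ultimately show ?case
    by (simp add: IH(2) w)
qed

end

section \<open>The iterated twisted product\<close>

text \<open>Algebras and morphisms as in the theorem, with naturality for the units written out as equations.\<close>

locale algebra_family = strict_monoidal_category C
  for C :: "('o, 'm, 'z) smc_scheme" (structure) +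
  fixes r :: nat and V :: "nat \<Rightarrow> 'o" and \<mu> \<nu> :: "nat \<Rightarrow> 'm" and \<xi> :: "nat \<Rightarrow> nat \<Rightarrow> 'm"
  assumes algebra: "1 \<le> i \<Longrightarrow> i \<le> r \<Longrightarrow> unital_assoc_algebra C (V i) (\<mu> i) (\<nu> i)"
    and swap_Hom: "1 \<le> i \<Longrightarrow> i < j \<Longrightarrow> j \<le> r \<Longrightarrow> \<xi> i j \<in> Hom C (V i \<odot> V j) (V j \<odot> V i)"
    and swap_unit_fst: "1 \<le> i \<Longrightarrow> i < j \<Longrightarrow> j \<le> r \<Longrightarrow> \<xi> i j \<cdot> (\<nu> i \<otimes> Id (V j)) = Id (V j) \<otimes> \<nu> i"
    and swap_unit_snd: "1 \<le> i \<Longrightarrow> i < j \<Longrightarrow> j \<le> r \<Longrightarrow> \<xi> i j \<cdot> (Id (V i) \<otimes> \<nu> j) = \<nu> j \<otimes> Id (V i)"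
begin

abbreviation "A n \<equiv> rev_obj C n V"
abbreviation "m n \<equiv> rev_mult C n V \<mu> \<xi>"
abbreviation "u n \<equiv> rev_unit C n \<nu>"
abbreviation (input) "word n \<equiv> map V (rev [1..<n+1])"

lemma objects: "1 \<le> i \<Longrightarrow> i \<le> r \<Longrightarrow> V i \<in> Obj C"
  and mult_Hom: "1 \<le> i \<Longrightarrow> i \<le> r \<Longrightarrow> \<mu> i \<in> Hom C (V i \<odot> V i) (V i)"
  and unit_Hom: "1 \<le> i \<Longrightarrow> i \<le> r \<Longrightarrow> \<nu> i \<in> Hom C \<I> (V i)"
  and mult_assoc: "1 \<le> i \<Longrightarrow> i \<le> r \<Longrightarrow> \<mu> i \<cdot> (\<mu> i \<otimes> Id (V i)) = \<mu> i \<cdot> (Id (V i) \<otimes> \<mu> i)"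
  and mult_unit_left: "1 \<le> i \<Longrightarrow> i \<le> r \<Longrightarrow> \<mu> i \<cdot> (\<nu> i \<otimes> Id (V i)) = Id (V i)"
  and mult_unit_right: "1 \<le> i \<Longrightarrow> i \<le> r \<Longrightarrow> \<mu> i \<cdot> (Id (V i) \<otimes> \<nu> i) = Id (V i)"
  using algebra by (auto simp: unital_assoc_algebra_def)

lemma word_simps: "word 0 = []" "word (Suc n) = V (Suc n) # word n"
  by simp_all

lemma word_objects: "n \<le> r \<Longrightarrow> set (word n) \<subseteq> Obj C"
  using objects by auto

lemma rev_obj_0: "A 0 = \<I>" and rev_obj_Suc: "A (Suc n) = V (Suc n) \<odot> A n"
  by (simp_all add: rev_obj_def otens_list_simps)

lemma rev_obj_Obj: "n \<le> r \<Longrightarrow> A n \<in> Obj C"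
  by (induction n) (simp_all add: rev_obj_0 rev_obj_Suc object_simps objects)

lemma rev_unit_0: "u 0 = Id \<I>" and rev_unit_Suc: "u (Suc n) = \<nu> (Suc n) \<otimes> u n"
  by (simp_all add: rev_unit_def mtens_list_def)

lemma rev_unit_Hom: "n \<le> r \<Longrightarrow> u n \<in> Hom C \<I> (A n)"
proof (induction n)
  case (Suc n)
  then have "u n \<in> Hom C \<I> (A n)" by simp
  from mtens_hom[OF unit_Hom this, of "Suc n"] Suc.prems show ?case
    by (simp add: rev_obj_Suc rev_unit_Suc object_simps)
qed (simp add: rev_obj_0 rev_unit_0 id_hom unit_obj)

text \<open>Moves \<open>V n\<close> from the right end of \<open>A k \<odot> V n\<close> to the left, past \<open>V 1\<close>, then \<open>V 2\<close>, up to \<open>V k\<close>.\<close>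

primrec sweep :: "nat \<Rightarrow> nat \<Rightarrow> 'm" where
  "sweep n 0 = Id (V n)"
| "sweep n (Suc k) = cable (V (Suc k)) (A k) (\<xi> (Suc k) n) (sweep n k)"

lemma sweep_Hom: "k < n \<Longrightarrow> n \<le> r \<Longrightarrow> sweep n k \<in> Hom C (A k \<odot> V n) (V n \<odot> A k)"
proof (induction k)
  case 0
  then show ?case by (simp add: rev_obj_0 object_simps objects id_hom)
next
  case (Suc k)
  then show ?case
    using cable_Hom[OF swap_Hom[of "Suc k" n] Suc.IH rev_obj_Obj objects objects]
    by (simp add: rev_obj_Suc)
qed

lemma sweep_unit_snd: "k < n \<Longrightarrow> n \<le> r \<Longrightarrow> sweep n k \<cdot> (Id (A k) \<otimes> \<nu> n) = \<nu> n \<otimes> Id (A k)"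
proof (induction k)
  case 0
  then have "\<nu> n \<in> Hom C \<I> (V n)" using unit_Hom by simp
  from HomD[OF this] show ?case
    by (simp add: rev_obj_0 mtens_unit_left mtens_unit_right comp_rules)
next
  case (Suc k)
  then show ?case
    using cable_natural_snd_unit[OF rev_obj_Obj objects objects swap_Hom sweep_Hom unit_Hom swap_unit_snd Suc.IH, of "Suc k"]
    by (simp add: rev_obj_Suc)
qed

lemma sweep_unit_fst: "k < n \<Longrightarrow> n \<le> r \<Longrightarrow> sweep n k \<cdot> (u k \<otimes> Id (V n)) = Id (V n) \<otimes> u k"
proof (induction k)
  case 0
  then show ?case
    by (simp add: rev_unit_0 mtens_unit_left mtens_unit_right comp_rules id_simps objects)
next
  case (Suc k)
  then show ?case
    using cable_natural_fst_unit[OF rev_obj_Obj objects objects swap_Hom sweep_Hom rev_unit_Hom unit_Hom swap_unit_fst Suc.IH, of "Suc k"]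
    by (simp add: rev_unit_Suc)
qed

text \<open>The positions at which \<open>\<xi> i n\<close> acts while \<open>V n\<close> travels through the word \<open>V k, \<dots>, V 1\<close>.\<close>

definition sweep_braid :: "nat \<Rightarrow> nat \<Rightarrow> ('m \<times> nat) list" where
  "sweep_braid n k = map (\<lambda>i. (\<xi> i n, k + 1 - i)) (rev [1..<k+1])"

lemma sweep_braid_Suc: "sweep_braid n (Suc k) = (\<xi> (Suc k) n, 1) # shift 1 (sweep_braid n k)"
  by (auto simp: sweep_braid_def shift_def)

lemma sweep_braid_word:
  "k < n \<Longrightarrow> n \<le> r \<Longrightarrow> admissible (sweep_braid n k) (word k @ [V n])
   \<and> permute (sweep_braid n k) (word k @ [V n]) = V n # word k
   \<and> braid_comp C (sweep_braid n k) (word k @ [V n]) = sweep n k"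
proof (induction k)
  case 0
  then show ?case by (simp add: sweep_braid_def otens_list_simps object_simps objects)
next
  case (Suc k)
  have w: "set (word k @ [V n]) \<subseteq> Obj C" and o: "V (Suc k) \<in> Obj C" "A k \<in> Obj C"
    using Suc.prems word_objects[of k] objects rev_obj_Obj by auto
  have s: "admissible (shift 1 (sweep_braid n k)) (V (Suc k) # word k @ [V n])"
    "permute (shift 1 (sweep_braid n k)) (V (Suc k) # word k @ [V n]) = V (Suc k) # V n # word k"
    "braid_comp C (shift 1 (sweep_braid n k)) (V (Suc k) # word k @ [V n]) = Id (V (Suc k)) \<otimes> sweep n k"
    using shift_word[of "[V (Suc k)]" "word k @ [V n]" "[]" "sweep_braid n k"] w o Suc HomD[OF sweep_Hom, of k n]
    by (simp_all add: otens_list_simps object_simps tens_simps id_simps mtens_unit_right)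
  have x: "\<xi> (Suc k) n \<in> Hom C (V (Suc k) \<odot> V n) (V n \<odot> V (Suc k))"
    using swap_Hom Suc.prems by simp
  have a: "act_at C (\<xi> (Suc k) n) 2 1 (V (Suc k) # V n # word k) = \<xi> (Suc k) n \<otimes> Id (A k)"
    using act_at_word[of "\<xi> (Suc k) n" "[]" "V (Suc k)" "V n" "word k"] HomD[OF x] o
    by (simp add: otens_list_simps mtens_unit_left tens_simps id_simps rev_obj_def del: map_map)
  have p: "swap_at 1 (V (Suc k) # V n # word k) = V n # word (Suc k)"
    using swap_at_word[of "[]" "V (Suc k)" "V n" "word k"] by simp
  show ?case
    using s x a p unfolding sweep_braid_Suc word_simps append_Cons sweep.simps cable_def
    by (auto simp: Cons_eq_append_conv)
qed

definition mult_braid :: "nat \<Rightarrow> ('m \<times> nat) list" where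
  "mult_braid n = concat (map (\<lambda>j. map (\<lambda>i. (\<xi> i j, 2 * n + 1 - i - j)) (rev [1..<j])) [2..<n+1])"

text \<open>In the braid for \<open>n + 1\<close> factors, the letter \<open>V (Suc n)\<close> of the second copy is moved first, past the \<open>n\<close> letters
  that follow \<open>V (Suc n)\<close> in the first copy: hence \<open>shift 1\<close>. The two letters \<open>V (Suc n)\<close> are then in front, and the
  rest is the braid for \<open>n\<close> factors: hence \<open>shift 2\<close>.\<close>

lemma mult_braid_Suc: "mult_braid (Suc n) = shift 2 (mult_braid n) @ shift 1 (sweep_braid (Suc n) n)"
proof (cases n)
  case 0
  then show ?thesis by (simp add: mult_braid_def sweep_braid_def shift_def)
next
  case (Suc n')
  then have 1: "[2..<Suc n + 1] = [2..<n+1] @ [Suc n]" by simp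
  have 2: "map (\<lambda>i. (\<xi> i (Suc n), 2 * Suc n + 1 - i - Suc n)) (rev [1..<Suc n]) = shift 1 (sweep_braid (Suc n) n)"
    by (auto simp: sweep_braid_def shift_def)
  have 3: "concat (map (\<lambda>j. map (\<lambda>i. (\<xi> i j, 2 * Suc n + 1 - i - j)) (rev [1..<j])) [2..<n+1]) = shift 2 (mult_braid n)"
    unfolding mult_braid_def shift_def map_concat map_map
    by (intro arg_cong[where f = concat] map_cong) auto
  show ?thesis unfolding 3[symmetric] 2[symmetric] mult_braid_def[of "Suc n"] 1 by simp
qed

definition paired_word :: "nat \<Rightarrow> 'o list" where
  "paired_word n = concat (map (\<lambda>i. [V i, V i]) (rev [1..<n+1]))"

lemma paired_word_simps: "paired_word 0 = []" "paired_word (Suc n) = V (Suc n) # V (Suc n) # paired_word n"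
  by (simp_all add: paired_word_def)

definition mults :: "nat \<Rightarrow> 'm" where "mults n = mtens_list C (map \<mu> (rev [1..<n+1]))"

lemma mults_simps: "mults 0 = Id \<I>" "mults (Suc n) = \<mu> (Suc n) \<otimes> mults n"
  by (simp_all add: mults_def mtens_list_def)

lemma rev_mult_eq: "m n = mults n \<cdot> braid_comp C (mult_braid n) (word n @ word n)"
  by (simp add: rev_mult_def mults_def mult_braid_def)

lemma mults_Hom: "n \<le> r \<Longrightarrow> otens_list C (paired_word n) \<in> Obj C \<and> mults n \<in> Hom C (otens_list C (paired_word n)) (A n)"
proof (induction n)
  case (Suc n)
  then have "mults n \<in> Hom C (otens_list C (paired_word n)) (A n)" "V (Suc n) \<in> Obj C" using objects by auto
  with mtens_hom[OF mult_Hom this(1), of "Suc n"] Suc show ?case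
    by (simp add: mults_simps paired_word_simps otens_list_simps object_simps rev_obj_Suc)
qed (simp add: mults_simps paired_word_simps otens_list_simps rev_obj_0 id_hom unit_obj)

lemma mult_braid_step:
  assumes "Suc n \<le> r" and adm: "admissible (mult_braid n) (word n @ word n)"
    and perm: "permute (mult_braid n) (word n @ word n) = paired_word n"
  shows "admissible (mult_braid (Suc n)) (word (Suc n) @ word (Suc n))"
    and "permute (mult_braid (Suc n)) (word (Suc n) @ word (Suc n)) = paired_word (Suc n)"
    and "m (Suc n) = twisted_mult (V (Suc n)) (A n) (\<mu> (Suc n)) (m n) (sweep (Suc n) n)"
proof -
  let ?V = "V (Suc n)"
  have w: "set (word n) \<subseteq> Obj C" and V: "?V \<in> Obj C" and A: "A n \<in> Obj C"
    using assms(1) word_objects[of n] objects rev_obj_Obj by auto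
  have sw: "sweep (Suc n) n \<in> Hom C (A n \<odot> ?V) (?V \<odot> A n)" using sweep_Hom assms(1) by simp
  have lw: "otens_list C (word n) = A n" by (simp add: rev_obj_def)
  have 1: "admissible (shift 1 (sweep_braid (Suc n) n)) (word (Suc n) @ word (Suc n))"
    "permute (shift 1 (sweep_braid (Suc n) n)) (word (Suc n) @ word (Suc n)) = ?V # ?V # word n @ word n"
    "braid_comp C (shift 1 (sweep_braid (Suc n) n)) (word (Suc n) @ word (Suc n)) = Id ?V \<otimes> sweep (Suc n) n \<otimes> Id (A n)"
    using shift_word[of "[?V]" "word n @ [?V]" "word n" "sweep_braid (Suc n) n"] sweep_braid_word[of n "Suc n"] w V assms(1) lw
    unfolding word_simps by (simp_all add: otens_list_simps object_simps del: upt_Suc)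
  let ?b = "braid_comp C (mult_braid n) (word n @ word n)"
  have b: "?b \<in> Hom C (A n \<odot> A n) (otens_list C (paired_word n))"
    using braid_comp_Hom[OF _ adm] w perm otens_list_append[OF w w] lw by simp
  have 2: "admissible (shift 2 (mult_braid n)) (?V # ?V # word n @ word n)"
    "permute (shift 2 (mult_braid n)) (?V # ?V # word n @ word n) = ?V # ?V # paired_word n"
    "braid_comp C (shift 2 (mult_braid n)) (?V # ?V # word n @ word n) = Id (?V \<odot> ?V) \<otimes> ?b"
    using shift_word[of "[?V, ?V]" "word n @ word n" "[]" "mult_braid n"] w V adm perm HomD[OF b]
    by (simp_all add: otens_list_simps object_simps tens_simps id_simps mtens_unit_right numeral_2_eq_2 del: upt_Suc)
  show "admissible (mult_braid (Suc n)) (word (Suc n) @ word (Suc n))"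
    unfolding mult_braid_Suc admissible_append using 1 2 by simp
  show "permute (mult_braid (Suc n)) (word (Suc n) @ word (Suc n)) = paired_word (Suc n)"
    unfolding mult_braid_Suc foldr_append paired_word_simps using 1 2 by simp
  have ww: "set (word (Suc n) @ word (Suc n)) \<subseteq> Obj C"
    using word_objects[OF assms(1)] by (simp only: set_append Un_least)
  have "braid_comp C (mult_braid (Suc n)) (word (Suc n) @ word (Suc n))
    = (Id (?V \<odot> ?V) \<otimes> ?b) \<cdot> (Id ?V \<otimes> sweep (Suc n) n \<otimes> Id (A n))"
    using braid_comp_append[OF ww 1(1), of "shift 2 (mult_braid n)"] 2(1)
    unfolding mult_braid_Suc 1(2,3) 2(3) by simp
  moreover have mu: "\<mu> (Suc n) \<in> Hom C (?V \<odot> ?V) ?V" using mult_Hom assms(1) by simp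
  moreover have mus: "mults n \<in> Hom C (otens_list C (paired_word n)) (A n)" using mults_Hom assms(1) by simp
  moreover have "(\<mu> (Suc n) \<otimes> mults n) \<cdot> (Id (?V \<odot> ?V) \<otimes> ?b) = \<mu> (Suc n) \<otimes> (mults n \<cdot> ?b)"
    using HomD[OF mu] HomD[OF mus] HomD[OF b] by (simp add: interchange comp_rules id_simps)
  ultimately show "m (Suc n) = twisted_mult ?V (A n) (\<mu> (Suc n)) (m n) (sweep (Suc n) n)"
    using HomD[OF b] HomD[OF sw] HomD[OF mu] HomD[OF mus] V A unfolding rev_mult_eq mults_simps twisted_mult_def
    by (simp add: comp_rules(3)[symmetric] tens_simps id_simps comp_simps object_simps del: upt_Suc)
qed

lemma mult_braid_word:
  "n \<le> r \<Longrightarrow> admissible (mult_braid n) (word n @ word n) \<and> permute (mult_braid n) (word n @ word n) = paired_word n"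
proof (induction n)
  case 0
  then show ?case by (simp add: mult_braid_def paired_word_simps)
next
  case (Suc n)
  then show ?case using mult_braid_step(1,2)[OF Suc.prems] by auto
qed

lemma rev_mult_0: "m 0 = Id \<I>"
  by (simp add: rev_mult_eq mults_simps mult_braid_def otens_list_simps comp_rules id_simps unit_obj)

text \<open>The key to the whole induction: the multiplication is an iterated twisted tensor product, the new
  factor being twisted with all the previous ones by \<open>sweep\<close>.\<close>

lemma rev_mult_Suc:
  assumes "Suc n \<le> r"
  shows "m (Suc n) = twisted_mult (V (Suc n)) (A n) (\<mu> (Suc n)) (m n) (sweep (Suc n) n)"
  using mult_braid_step(3)[OF assms] mult_braid_word[of n] assms by simp

lemma rev_mult_Hom: "n \<le> r \<Longrightarrow> m n \<in> Hom C (A n \<odot> A n) (A n)"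
proof (induction n)
  case 0
  then show ?case by (simp add: rev_mult_0 rev_obj_0 object_simps id_hom)
next
  case (Suc n)
  then show ?case
    using twisted_mult_Hom[OF mult_Hom Suc.IH sweep_Hom rev_obj_Obj objects, of "Suc n"]
    by (simp add: rev_mult_Suc rev_obj_Suc)
qed

text \<open>The unit laws need only naturality with respect to the units, so that of the algebra axioms on \<open>A n\<close>
  associativity alone remains to be characterized.\<close>

lemma rev_mult_units:
  "n \<le> r \<Longrightarrow> m n \<cdot> (u n \<otimes> Id (A n)) = Id (A n) \<and> m n \<cdot> (Id (A n) \<otimes> u n) = Id (A n)"
proof (induction n)
  case 0
  then show ?case
    by (simp add: rev_mult_0 rev_obj_0 rev_unit_0 mtens_id object_simps comp_rules id_simps)
next
  case (Suc n)
  then have 1: "1 \<le> Suc n" "Suc n \<le> r" "n \<le> r" "n < Suc n" by auto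
  show ?case
    using twisted_mult_unit[OF rev_obj_Obj[OF 1(3)] objects[OF 1(1,2)] sweep_Hom[OF 1(4,2)] rev_mult_Hom[OF 1(3)]
      mult_Hom[OF 1(1,2)] rev_unit_Hom[OF 1(3)] unit_Hom[OF 1(1,2)] _ _ mult_unit_left[OF 1(1,2)] mult_unit_right[OF 1(1,2)]
      sweep_unit_fst[OF 1(4,2)] sweep_unit_snd[OF 1(4,2)]] Suc.IH[OF 1(3)]
    by (simp add: rev_mult_Suc[OF 1(2)] rev_obj_Suc rev_unit_Suc)
qed

section \<open>Compatibility implies associativity\<close>

text \<open>Condition (B) for the first \<open>n\<close> algebras, with the naturality squares written out.\<close>

definition compatible :: "nat \<Rightarrow> bool" where
  "compatible n \<longleftrightarrow>
    (\<forall>i j. 1 \<le> i \<and> i < j \<and> j \<le> n \<longrightarrow>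
      \<xi> i j \<cdot> (\<mu> i \<otimes> Id (V j)) = (Id (V j) \<otimes> \<mu> i) \<cdot> (\<xi> i j \<otimes> Id (V i)) \<cdot> (Id (V i) \<otimes> \<xi> i j) \<and>
      \<xi> i j \<cdot> (Id (V i) \<otimes> \<mu> j) = (\<mu> j \<otimes> Id (V i)) \<cdot> (Id (V j) \<otimes> \<xi> i j) \<cdot> (\<xi> i j \<otimes> Id (V j))) \<and>
    (\<forall>i j k. 1 \<le> i \<and> i < j \<and> j < k \<and> k \<le> n \<longrightarrow>
      yang_baxter (V i) (V j) (V k) (\<xi> i j) (\<xi> i k) (\<xi> j k))"

definition associative :: "nat \<Rightarrow> bool" where
  "associative n \<longleftrightarrow> m n \<cdot> (m n \<otimes> Id (A n)) = m n \<cdot> (Id (A n) \<otimes> m n)"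

lemma associative_0: "associative 0"
  by (simp add: associative_def rev_mult_0 rev_obj_0)

context
  assumes compatible: "compatible r"
begin

lemma sweep_mult_snd:
  "k < n \<Longrightarrow> n \<le> r \<Longrightarrow>
    sweep n k \<cdot> (Id (A k) \<otimes> \<mu> n) = (\<mu> n \<otimes> Id (A k)) \<cdot> (Id (V n) \<otimes> sweep n k) \<cdot> (sweep n k \<otimes> Id (V n))"
proof (induction k)
  case 0
  then have 1: "1 \<le> n" "n \<le> r" by auto
  note h = HomD[OF mult_Hom[OF 1]]
  show ?case using h objects[OF 1]
    by (simp add: rev_obj_0 mtens_unit_left mtens_unit_right comp_rules mtens_id id_simps object_simps)
next
  case (Suc k)
  then have 1: "1 \<le> n" "n \<le> r" "1 \<le> Suc k" "Suc k \<le> r" "k \<le> r" "k < n" "Suc k < n" by auto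
  have "\<xi> (Suc k) n \<cdot> (Id (V (Suc k)) \<otimes> \<mu> n)
      = (\<mu> n \<otimes> Id (V (Suc k))) \<cdot> (Id (V n) \<otimes> \<xi> (Suc k) n) \<cdot> (\<xi> (Suc k) n \<otimes> Id (V n))"
    using compatible 1 unfolding compatible_def by blast
  from cable_natural_snd_mult[OF rev_obj_Obj[OF 1(5)] objects[OF 1(3,4)] objects[OF 1(1,2)]
    swap_Hom[OF 1(3,7,2)] sweep_Hom[OF 1(6,2)] mult_Hom[OF 1(1,2)] this Suc.IH[OF 1(6,2)]]
  show ?case by (simp add: rev_obj_Suc)
qed

text \<open>Only the first object is a tensor product, so that the equation for \<open>A l\<close> is built up from the equations
  for the letters with \<open>cable_yang_baxter\<close>.\<close>

lemma sweep_yang_baxter: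
  "l < k \<Longrightarrow> k < n \<Longrightarrow> n \<le> r \<Longrightarrow> yang_baxter (A l) (V k) (V n) (sweep k l) (sweep n l) (\<xi> k n)"
proof (induction l)
  case 0
  then have "\<xi> k n \<in> Hom C (V k \<odot> V n) (V n \<odot> V k)" "V k \<in> Obj C" "V n \<in> Obj C"
    using swap_Hom objects by auto
  with HomD[OF this(1)] show ?case
    by (simp add: yang_baxter_def rev_obj_0 mtens_unit_left mtens_unit_right mtens_id comp_rules id_simps object_simps)
next
  case (Suc l)
  then have 1: "1 \<le> n" "n \<le> r" "1 \<le> Suc l" "Suc l \<le> r" "l \<le> r" "l < n" "Suc l < n"
     "1 \<le> k" "k \<le> r" "l < k" "Suc l < k" "k < n" by auto
  have "yang_baxter (V (Suc l)) (V k) (V n) (\<xi> (Suc l) k) (\<xi> (Suc l) n) (\<xi> k n)"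
    using compatible 1 unfolding compatible_def by blast
  from cable_yang_baxter[OF rev_obj_Obj[OF 1(5)] objects[OF 1(3,4)] objects[OF 1(1,2)]
    swap_Hom[OF 1(3,7,2)] sweep_Hom[OF 1(6,2)] objects[OF 1(8,9)] swap_Hom[OF 1(8,12,2)]
    swap_Hom[OF 1(3,11,9)] sweep_Hom[OF 1(10,9)] this Suc.IH[OF 1(10,12,2)]]
  show ?case by (simp add: rev_obj_Suc)
qed

lemma sweep_mult_fst:
  "k < n \<Longrightarrow> n \<le> r \<Longrightarrow>
    sweep n k \<cdot> (m k \<otimes> Id (V n)) = (Id (V n) \<otimes> m k) \<cdot> (sweep n k \<otimes> Id (A k)) \<cdot> (Id (A k) \<otimes> sweep n k)"
proof (induction k)
  case 0
  then have "V n \<in> Obj C" using objects by auto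
  then show ?case
    by (simp add: rev_obj_0 rev_mult_0 mtens_unit_left mtens_unit_right comp_rules mtens_id id_simps object_simps)
next
  case (Suc k)
  then have 1: "1 \<le> n" "n \<le> r" "1 \<le> Suc k" "Suc k \<le> r" "k \<le> r" "k < n" "Suc k < n" "k < Suc k" by auto
  have "\<xi> (Suc k) n \<cdot> (\<mu> (Suc k) \<otimes> Id (V n))
      = (Id (V n) \<otimes> \<mu> (Suc k)) \<cdot> (\<xi> (Suc k) n \<otimes> Id (V (Suc k))) \<cdot> (Id (V (Suc k)) \<otimes> \<xi> (Suc k) n)"
    using compatible 1 unfolding compatible_def by blast
  from cable_natural_fst_twisted_mult[OF rev_obj_Obj[OF 1(5)] objects[OF 1(3,4)] objects[OF 1(1,2)]
    swap_Hom[OF 1(3,7,2)] sweep_Hom[OF 1(6,2)] sweep_Hom[OF 1(8,4)] rev_mult_Hom[OF 1(5)] mult_Hom[OF 1(3,4)]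
    Suc.IH[OF 1(6,2)] this sweep_yang_baxter[OF 1(8,7,2)]]
  show ?case by (simp add: rev_obj_Suc rev_mult_Suc[OF 1(4)])
qed

lemma compatible_imp_associative: "n \<le> r \<Longrightarrow> associative n"
proof (induction n)
  case (Suc k)
  then have 1: "1 \<le> Suc k" "Suc k \<le> r" "k \<le> r" "k < Suc k" by auto
  show ?case
    using twisted_mult_assoc[OF rev_obj_Obj[OF 1(3)] objects[OF 1(1,2)] sweep_Hom[OF 1(4,2)] rev_mult_Hom[OF 1(3)]
     mult_Hom[OF 1(1,2)] Suc.IH[OF 1(3), unfolded associative_def] mult_assoc[OF 1(1,2)] sweep_mult_fst[OF 1(4,2)] sweep_mult_snd[OF 1(4,2)]]
    by (simp add: associative_def rev_mult_Suc[OF 1(2)] rev_obj_Suc)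
qed (rule associative_0)

end

end

section \<open>Associativity implies compatibility\<close>

locale split_algebra_family = algebra_family +
  assumes split_unit: "1 \<le> i \<Longrightarrow> i \<le> r \<Longrightarrow> \<exists>e \<in> Hom C (V i) \<I>. e \<cdot> \<nu> i = Id \<I>"
begin

text \<open>The embedding of \<open>V i\<close> into \<open>A n\<close>, with the units in all other positions. The value for \<open>n = 0\<close>
  is arbitrary.\<close>

primrec inclusion :: "nat \<Rightarrow> nat \<Rightarrow> 'b" where
  "inclusion 0 i = Id \<I>"
| "inclusion (Suc n) i = (if i = Suc n then Id (V (Suc n)) \<otimes> u n else \<nu> (Suc n) \<otimes> inclusion n i)"

lemma split_mono_unit: "1 \<le> i \<Longrightarrow> i \<le> r \<Longrightarrow> split_mono (\<nu> i) \<I> (V i)"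
  unfolding split_mono_def using split_unit unit_Hom by blast

lemma split_mono_rev_unit: "n \<le> r \<Longrightarrow> split_mono (u n) \<I> (A n)"
proof (induction n)
  case (Suc n)
  then show ?case using split_mono_tens[OF split_mono_unit Suc.IH, of "Suc n"]
    by (simp add: rev_unit_Suc rev_obj_Suc object_simps)
qed (simp add: rev_unit_0 rev_obj_0 split_mono_id unit_obj)

lemma split_mono_inclusion: "1 \<le> i \<Longrightarrow> i \<le> n \<Longrightarrow> n \<le> r \<Longrightarrow> split_mono (inclusion n i) (V i) (A n)"
proof (induction n)
  case (Suc n)
  show ?case
  proof (cases "i = Suc n")
    case True
    then show ?thesis
      using split_mono_tens[OF split_mono_id split_mono_rev_unit, of "V i" n] Suc.prems objects
      by (simp add: rev_obj_Suc object_simps)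
  next
    case False
    then show ?thesis
      using split_mono_tens[OF split_mono_unit Suc.IH, of "Suc n"] Suc.prems objects[of i]
      by (simp add: rev_obj_Suc object_simps)
  qed
qed simp

lemma inclusion_Hom: "1 \<le> i \<Longrightarrow> i \<le> n \<Longrightarrow> n \<le> r \<Longrightarrow> inclusion n i \<in> Hom C (V i) (A n)"
  using split_mono_inclusion unfolding split_mono_def by blast

lemma inclusion_last: "inclusion (Suc n) (Suc n) = Id (V (Suc n)) \<otimes> u n"
  by simp

lemma inclusion_lift:
  assumes "1 \<le> i" "i \<le> n" "Suc n \<le> r"
  shows "inclusion (Suc n) i = (\<nu> (Suc n) \<otimes> Id (A n)) \<cdot> inclusion n i"
proof -
  have 1: "1 \<le> Suc n" "Suc n \<le> r" "n \<le> r" using assms by auto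
  note h = HomD[OF unit_Hom[OF 1(1,2)]] HomD[OF inclusion_Hom[OF assms(1,2) 1(3)]]
  have "(\<nu> (Suc n) \<otimes> Id (A n)) \<cdot> (Id \<I> \<otimes> inclusion n i) = \<nu> (Suc n) \<otimes> inclusion n i"
    using h by (simp add: interchange comp_rules id_simps)
  then show ?thesis using assms h by (simp add: mtens_unit_left)
qed

text \<open>Moving \<open>V n\<close> past \<open>V i\<close> surrounded by units costs only \<open>\<xi> i n\<close>, since the units are passed by naturality.\<close>

lemma sweep_inclusion:
  "1 \<le> i \<Longrightarrow> i \<le> k \<Longrightarrow> k < n \<Longrightarrow> n \<le> r \<Longrightarrow>
    sweep n k \<cdot> (inclusion k i \<otimes> Id (V n)) = (Id (V n) \<otimes> inclusion k i) \<cdot> \<xi> i n"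
proof (induction k)
  case (Suc k)
  then have 1: "1 \<le> n" "n \<le> r" "1 \<le> Suc k" "Suc k \<le> r" "k \<le> r" "k < n" "Suc k < n" by auto
  note o = objects[OF 1(1,2)] objects[OF 1(3,4)] rev_obj_Obj[OF 1(5)]
  have x: "\<xi> (Suc k) n \<in> Hom C (V (Suc k) \<odot> V n) (V n \<odot> V (Suc k))" and s: "sweep n k \<in> Hom C (A k \<odot> V n) (V n \<odot> A k)"
    using swap_Hom sweep_Hom 1 by auto
  note u = rev_unit_Hom[OF 1(5)] and v = unit_Hom[OF 1(3,4)]
  show ?case
  proof (cases "i = Suc k")
    case True
    note [simp] = layer_simps o x[THEN hom_type_Hom] s[THEN hom_type_Hom] u[THEN hom_type_Hom]
    note rules = layer_cong[OF sweep_unit_fst[OF 1(6,2)], of "V (Suc k)" \<I>, simplified]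
      layer_exchange[OF x u, of \<I> \<I> \<I>, simplified]
    show ?thesis
      unfolding True inclusion_last sweep.simps cable_def
      by (rule eqI_Some) (simp add: rules rules[THEN seq_tail, simplified seq_assoc])
  next
    case False
    then have i: "1 \<le> i" "i \<le> k" "i < n" using Suc.prems by auto
    note y = swap_Hom[OF i(1,3) 1(2)] and j = inclusion_Hom[OF i(1,2) 1(5)]
    have oi: "V i \<in> Obj C" using i 1 objects by simp
    note [simp] = layer_simps o oi x[THEN hom_type_Hom] s[THEN hom_type_Hom] y[THEN hom_type_Hom] j[THEN hom_type_Hom] v[THEN hom_type_Hom]
    note rules = layer_cong[OF Suc.IH[OF i(1,2) 1(6,2)], of \<I> \<I>, simplified]
       layer_cong[OF swap_unit_fst[OF 1(3,7,2)], of \<I> "A k", simplified]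
       layer_exchange[OF v s, of \<I> \<I> \<I>, symmetric, simplified]
       layer_exchange[OF v j, of \<I> \<I> "V n", symmetric, simplified]
    have e: "inclusion (Suc k) i = \<nu> (Suc k) \<otimes> inclusion k i" using False by simp
    show ?thesis
      unfolding e sweep.simps cable_def
      by (rule eqI_Some) (simp add: rules rules[THEN seq_tail, simplified seq_assoc])
  qed
qed simp

context
  fixes n assumes n: "Suc n \<le> r"
begin

lemma rev_mult_Suc_inclusions:
  "m (Suc n) \<cdot> ((\<nu> (Suc n) \<otimes> Id (A n)) \<otimes> (\<nu> (Suc n) \<otimes> Id (A n))) = (\<nu> (Suc n) \<otimes> Id (A n)) \<cdot> m n"
  "m (Suc n) \<cdot> ((Id (V (Suc n)) \<otimes> u n) \<otimes> (Id (V (Suc n)) \<otimes> u n)) = (Id (V (Suc n)) \<otimes> u n) \<cdot> \<mu> (Suc n)"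
  "m (Suc n) \<cdot> ((\<nu> (Suc n) \<otimes> Id (A n)) \<otimes> (Id (V (Suc n)) \<otimes> u n)) = sweep (Suc n) n"
  "m (Suc n) \<cdot> ((Id (V (Suc n)) \<otimes> u n) \<otimes> (\<nu> (Suc n) \<otimes> Id (A n))) = Id (A (Suc n))"
  and associative_Suc_imp: "associative (Suc n) \<Longrightarrow>
    \<nu> (Suc n) \<otimes> (m n \<cdot> (m n \<otimes> Id (A n))) = \<nu> (Suc n) \<otimes> (m n \<cdot> (Id (A n) \<otimes> m n))"
   "associative (Suc n) \<Longrightarrow> sweep (Suc n) n \<cdot> (m n \<otimes> Id (V (Suc n)))
     = (Id (V (Suc n)) \<otimes> m n) \<cdot> (sweep (Suc n) n \<otimes> Id (A n)) \<cdot> (Id (A n) \<otimes> sweep (Suc n) n)"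
   "associative (Suc n) \<Longrightarrow> sweep (Suc n) n \<cdot> (Id (A n) \<otimes> \<mu> (Suc n))
     = (\<mu> (Suc n) \<otimes> Id (A n)) \<cdot> (Id (V (Suc n)) \<otimes> sweep (Suc n) n) \<cdot> (sweep (Suc n) n \<otimes> Id (V (Suc n)))"
proof -
  have 1: "1 \<le> Suc n" "Suc n \<le> r" "n \<le> r" "n < Suc n" using n by auto
  note facts = rev_obj_Obj[OF 1(3)] objects[OF 1(1,2)] sweep_Hom[OF 1(4,2)] rev_mult_Hom[OF 1(3)]
      mult_Hom[OF 1(1,2)] rev_unit_Hom[OF 1(3)] unit_Hom[OF 1(1,2)]
      rev_mult_units[OF 1(3), THEN conjunct1] rev_mult_units[OF 1(3), THEN conjunct2]
      mult_unit_left[OF 1(1,2)] mult_unit_right[OF 1(1,2)]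
      sweep_unit_fst[OF 1(4,2)] sweep_unit_snd[OF 1(4,2)]
  note t = twisted_mult_inclusions[OF facts]
  note d = rev_mult_Suc[OF 1(2)] rev_obj_Suc associative_def
  show "m (Suc n) \<cdot> ((\<nu> (Suc n) \<otimes> Id (A n)) \<otimes> (\<nu> (Suc n) \<otimes> Id (A n))) = (\<nu> (Suc n) \<otimes> Id (A n)) \<cdot> m n"
  "m (Suc n) \<cdot> ((Id (V (Suc n)) \<otimes> u n) \<otimes> (Id (V (Suc n)) \<otimes> u n)) = (Id (V (Suc n)) \<otimes> u n) \<cdot> \<mu> (Suc n)"
  "m (Suc n) \<cdot> ((\<nu> (Suc n) \<otimes> Id (A n)) \<otimes> (Id (V (Suc n)) \<otimes> u n)) = sweep (Suc n) n"
  "m (Suc n) \<cdot> ((Id (V (Suc n)) \<otimes> u n) \<otimes> (\<nu> (Suc n) \<otimes> Id (A n))) = Id (A (Suc n))"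
    unfolding d by (rule t)+
  note a = twisted_mult_assoc_imp[OF facts]
  show "associative (Suc n) \<Longrightarrow>
    \<nu> (Suc n) \<otimes> (m n \<cdot> (m n \<otimes> Id (A n))) = \<nu> (Suc n) \<otimes> (m n \<cdot> (Id (A n) \<otimes> m n))"
   "associative (Suc n) \<Longrightarrow> sweep (Suc n) n \<cdot> (m n \<otimes> Id (V (Suc n)))
     = (Id (V (Suc n)) \<otimes> m n) \<cdot> (sweep (Suc n) n \<otimes> Id (A n)) \<cdot> (Id (A n) \<otimes> sweep (Suc n) n)"
   "associative (Suc n) \<Longrightarrow> sweep (Suc n) n \<cdot> (Id (A n) \<otimes> \<mu> (Suc n))
     = (\<mu> (Suc n) \<otimes> Id (A n)) \<cdot> (Id (V (Suc n)) \<otimes> sweep (Suc n) n) \<cdot> (sweep (Suc n) n \<otimes> Id (V (Suc n)))"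
    unfolding d by (rule a, assumption)+
qed

text \<open>The smaller product is a subalgebra of the larger one, and the normalization of \<open>\<nu> (Suc n)\<close> cancels its
  embedding.\<close>

lemma associative_pred:
  assumes "associative (Suc n)" shows "associative n"
proof -
  obtain e where e: "e \<in> Hom C (V (Suc n)) \<I>" "e \<cdot> \<nu> (Suc n) = Id \<I>" using split_unit[of "Suc n"] n by auto
  have h: "m n \<in> Hom C (A n \<odot> A n) (A n)" "A n \<in> Obj C" using rev_mult_Hom rev_obj_Obj n by auto
  have 1: "m n \<cdot> (m n \<otimes> Id (A n)) \<in> Hom C (A n \<odot> A n \<odot> A n) (A n)"
    using comp_hom[OF mtens_hom[OF h(1) id_hom[OF h(2)]] h(1)] h(2) by (simp add: object_simps)
  have 2: "m n \<cdot> (Id (A n) \<otimes> m n) \<in> Hom C (A n \<odot> A n \<odot> A n) (A n)"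
    by (rule comp_hom[OF mtens_hom[OF id_hom[OF h(2)] h(1)] h(1)])
  show ?thesis unfolding associative_def
    by (rule unit_tensor_cancel[OF unit_Hom[of "Suc n"] e 1 2 associative_Suc_imp(1)[OF assms]]) (use n in auto)
qed

end

lemma rev_mult_inclusion_same:
  "1 \<le> i \<Longrightarrow> i \<le> n \<Longrightarrow> n \<le> r \<Longrightarrow> m n \<cdot> (inclusion n i \<otimes> inclusion n i) = inclusion n i \<cdot> \<mu> i"
proof (induction n)
  case (Suc n)
  show ?case
  proof (cases "i = Suc n")
    case True
    then show ?thesis using rev_mult_Suc_inclusions(2)[OF Suc.prems(3)] by simp
  next
    case False
    then have i: "1 \<le> i" "i \<le> n" "n \<le> r" "i \<le> r" using Suc.prems by auto
    have v: "\<nu> (Suc n) \<otimes> Id (A n) \<in> Hom C (A n) (A (Suc n))"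
      using mtens_hom[OF unit_Hom id_hom, of "Suc n" "A n"] Suc.prems rev_obj_Obj[of n] by (simp add: object_simps rev_obj_Suc)
    note j = inclusion_Hom[OF i(1-3)]
    show ?thesis
      unfolding inclusion_lift[OF i(1,2) Suc.prems(3)] comp_tens_comp[OF j v j v rev_mult_Hom[OF Suc.prems(3)]]
       rev_mult_Suc_inclusions(1)[OF Suc.prems(3)]
       comp_assoc[OF mtens_hom[OF j j] rev_mult_Hom[OF i(3)] v] Suc.IH[OF i(1-3)]
       comp_assoc[OF mult_Hom[OF i(1,4)] j v] ..
  qed
qed simp

text \<open>In the order \<open>j, i\<close> in which the factors occur in \<open>A n\<close>, the product merely places them side by side and
  therefore is a split monomorphism; in the opposite order they first have to be exchanged by \<open>\<xi> i j\<close>.\<close>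

lemma rev_mult_inclusion_pair:
  "1 \<le> i \<Longrightarrow> i < j \<Longrightarrow> j \<le> n \<Longrightarrow> n \<le> r \<Longrightarrow>
    split_mono (m n \<cdot> (inclusion n j \<otimes> inclusion n i)) (V j \<odot> V i) (A n) \<and>
    m n \<cdot> (inclusion n i \<otimes> inclusion n j) = (m n \<cdot> (inclusion n j \<otimes> inclusion n i)) \<cdot> \<xi> i j"
proof (induction n)
  case (Suc n)
  then have i: "1 \<le> i" "i \<le> n" "n \<le> r" "i \<le> r" "1 \<le> Suc n" "n < Suc n" by auto
  note n = Suc.prems(4) and mh = rev_mult_Hom[OF Suc.prems(4)]
  note o = objects[OF i(5) n] objects[OF i(1,4)] rev_obj_Obj[OF i(3)] rev_obj_Obj[OF n]
  have vs: "split_mono (\<nu> (Suc n) \<otimes> Id (A n)) (A n) (A (Suc n))"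
    using split_mono_tens[OF split_mono_unit[OF i(5) n] split_mono_id[OF o(3)]] o by (simp add: object_simps rev_obj_Suc)
  then have v: "\<nu> (Suc n) \<otimes> Id (A n) \<in> Hom C (A n) (A (Suc n))" by (simp add: split_mono_def)
  have w: "Id (V (Suc n)) \<otimes> u n \<in> Hom C (V (Suc n)) (A (Suc n))"
    using inclusion_Hom[OF i(5) le_refl n] by simp
  note ii = inclusion_Hom[OF i(1-3)]
  show ?case
  proof (cases "j = Suc n")
    case True
    have x: "\<xi> i (Suc n) \<in> Hom C (V i \<odot> V (Suc n)) (V (Suc n) \<odot> V i)" using swap_Hom i n by simp
    note idV = id_hom[OF o(1)]
    have 1: "m (Suc n) \<cdot> (inclusion (Suc n) (Suc n) \<otimes> inclusion (Suc n) i) = Id (V (Suc n)) \<otimes> inclusion n i"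
    proof -
      have "m (Suc n) \<cdot> (((Id (V (Suc n)) \<otimes> u n) \<cdot> Id (V (Suc n))) \<otimes> ((\<nu> (Suc n) \<otimes> Id (A n)) \<cdot> inclusion n i))
        = Id (V (Suc n)) \<otimes> inclusion n i"
        unfolding comp_tens_comp[OF idV w ii v mh] rev_mult_Suc_inclusions(4)[OF n] rev_obj_Suc
        by (rule comp_id_left[OF mtens_hom[OF idV ii]])
      then show ?thesis unfolding inclusion_last inclusion_lift[OF i(1,2) n] comp_id_right[OF w] .
    qed
    have 2: "m (Suc n) \<cdot> (inclusion (Suc n) i \<otimes> inclusion (Suc n) (Suc n)) = (Id (V (Suc n)) \<otimes> inclusion n i) \<cdot> \<xi> i (Suc n)"
    proof -
      have "m (Suc n) \<cdot> (((\<nu> (Suc n) \<otimes> Id (A n)) \<cdot> inclusion n i) \<otimes> ((Id (V (Suc n)) \<otimes> u n) \<cdot> Id (V (Suc n))))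
        = (Id (V (Suc n)) \<otimes> inclusion n i) \<cdot> \<xi> i (Suc n)"
        unfolding comp_tens_comp[OF ii v idV w mh] rev_mult_Suc_inclusions(3)[OF n]
        by (rule sweep_inclusion[OF i(1,2,6) n])
      then show ?thesis unfolding inclusion_last inclusion_lift[OF i(1,2) n] comp_id_right[OF w] .
    qed
    show ?thesis unfolding True 1 2
      using split_mono_tens[OF split_mono_id[OF o(1)] split_mono_inclusion[OF i(1-3)]] by (simp add: rev_obj_Suc)
  next
    case False
    then have j: "1 \<le> j" "j \<le> n" "j \<le> r" using Suc.prems by auto
    note jj = inclusion_Hom[OF j(1,2) i(3)]
    note IH = Suc.IH[OF i(1) Suc.prems(2) j(2) i(3)]
    have k: "m n \<cdot> (inclusion n j \<otimes> inclusion n i) \<in> Hom C (V j \<odot> V i) (A n)" using IH by (simp add: split_mono_def)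
    have x: "\<xi> i j \<in> Hom C (V i \<odot> V j) (V j \<odot> V i)" using swap_Hom i(1) Suc.prems(2) j(3) by simp
    have 1: "m (Suc n) \<cdot> (inclusion (Suc n) j \<otimes> inclusion (Suc n) i) = (\<nu> (Suc n) \<otimes> Id (A n)) \<cdot> (m n \<cdot> (inclusion n j \<otimes> inclusion n i))"
      unfolding inclusion_lift[OF i(1,2) n] inclusion_lift[OF j(1,2) n] comp_tens_comp[OF jj v ii v mh]
       rev_mult_Suc_inclusions(1)[OF n] by (rule comp_assoc[OF mtens_hom[OF jj ii] rev_mult_Hom[OF i(3)] v])
    have 2: "m (Suc n) \<cdot> (inclusion (Suc n) i \<otimes> inclusion (Suc n) j) = (\<nu> (Suc n) \<otimes> Id (A n)) \<cdot> (m n \<cdot> (inclusion n i \<otimes> inclusion n j))"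
      unfolding inclusion_lift[OF i(1,2) n] inclusion_lift[OF j(1,2) n] comp_tens_comp[OF ii v jj v mh]
       rev_mult_Suc_inclusions(1)[OF n] by (rule comp_assoc[OF mtens_hom[OF ii jj] rev_mult_Hom[OF i(3)] v])
    show ?thesis unfolding 1 2
      using split_mono_comp[OF IH[THEN conjunct1] vs] IH comp_assoc[OF x k v] by simp
  qed
qed simp

text \<open>By induction, only the equations involving the last index are new. Associativity makes \<open>sweep (Suc n) n\<close> natural
  with respect to both multiplications, and the new equations are the restrictions of these two facts along the
  inclusions.\<close>

lemma associative_imp_compatible: "n \<le> r \<Longrightarrow> associative n \<Longrightarrow> compatible n"
proof (induction n)
  case 0
  then show ?case by (simp add: compatible_def)
next
  case (Suc n)
  note n = Suc.prems(1)
  have n': "n \<le> r" "n < Suc n" "1 \<le> Suc n" using n by auto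
  note c = Suc.IH[OF n'(1) associative_pred[OF n Suc.prems(2)]]
  note nat = associative_Suc_imp(2,3)[OF n Suc.prems(2)]
  note o = rev_obj_Obj[OF n'(1)] objects[OF n'(3) n]
  note s = sweep_Hom[OF n'(2) n] and mh = rev_mult_Hom[OF n'(1)]
  have pair: "\<xi> i (Suc n) \<cdot> (\<mu> i \<otimes> Id (V (Suc n))) = (Id (V (Suc n)) \<otimes> \<mu> i) \<cdot> (\<xi> i (Suc n) \<otimes> Id (V i)) \<cdot> (Id (V i) \<otimes> \<xi> i (Suc n)) \<and>
      \<xi> i (Suc n) \<cdot> (Id (V i) \<otimes> \<mu> (Suc n)) = (\<mu> (Suc n) \<otimes> Id (V i)) \<cdot> (Id (V (Suc n)) \<otimes> \<xi> i (Suc n)) \<cdot> (\<xi> i (Suc n) \<otimes> Id (V (Suc n)))"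
    if i: "1 \<le> i" "i \<le> n" for i
  proof -
    have i': "i < Suc n" "i \<le> r" using i n by auto
    note ii = inclusion_Hom[OF i n'(1)]
    obtain p where p: "p \<in> Hom C (A n) (V i)" "p \<cdot> inclusion n i = Id (V i)"
      using split_mono_inclusion[OF i n'(1)] by (auto simp: split_mono_def)
    note x = swap_Hom[OF i(1) i'(1) n] and si = sweep_inclusion[OF i n'(2) n]
    show ?thesis
      using natural_fst_mult_restrict[OF o objects[OF i(1) i'(2)] s x ii p si mh mult_Hom[OF i(1) i'(2)]
          rev_mult_inclusion_same[OF i n'(1)] nat(1)]
        natural_snd_mult_restrict[OF o objects[OF i(1) i'(2)] s x ii p si mult_Hom[OF n'(3) n] nat(2)]
      by blast
  qed
  have triple: "yang_baxter (V i) (V j) (V (Suc n)) (\<xi> i j) (\<xi> i (Suc n)) (\<xi> j (Suc n))"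
    if i: "1 \<le> i" "i < j" "j \<le> n" for i j
  proof -
    have i': "i \<le> n" "i < Suc n" "i \<le> r" "1 \<le> j" "j < Suc n" "j \<le> r" using i n by auto
    note q = rev_mult_inclusion_pair[OF i n'(1)]
    obtain p where p: "p \<in> Hom C (A n) (V j \<odot> V i)" "p \<cdot> (m n \<cdot> (inclusion n j \<otimes> inclusion n i)) = Id (V j \<odot> V i)"
      using q by (auto simp: split_mono_def)
    show ?thesis
      by (rule yang_baxter_restrict[OF o objects[OF i(1) i'(3)] objects[OF i'(4,6)] s swap_Hom[OF i(1) i'(2) n] swap_Hom[OF i'(4,5) n]
        swap_Hom[OF i(1,2) i'(6)] inclusion_Hom[OF i(1) i'(1) n'(1)] inclusion_Hom[OF i'(4) i(3) n'(1)] mh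
        sweep_inclusion[OF i(1) i'(1) n'(2) n] sweep_inclusion[OF i'(4) i(3) n'(2) n] nat(1) q[THEN conjunct2] p])
  qed
  show ?case
    unfolding compatible_def
  proof (intro conjI allI impI; elim conjE)
    fix i j assume ij: "1 \<le> i" "i < j" "j \<le> Suc n"
    have "(\<xi> i j \<cdot> (\<mu> i \<otimes> Id (V j)) = (Id (V j) \<otimes> \<mu> i) \<cdot> (\<xi> i j \<otimes> Id (V i)) \<cdot> (Id (V i) \<otimes> \<xi> i j) \<and>
      \<xi> i j \<cdot> (Id (V i) \<otimes> \<mu> j) = (\<mu> j \<otimes> Id (V i)) \<cdot> (Id (V j) \<otimes> \<xi> i j) \<cdot> (\<xi> i j \<otimes> Id (V j)))"
    proof (cases "j = Suc n")
      case True
      then show ?thesis using pair[of i] ij by simp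
    next
      case False
      then show ?thesis using c ij unfolding compatible_def by simp
    qed
    then show "\<xi> i j \<cdot> (\<mu> i \<otimes> Id (V j)) = (Id (V j) \<otimes> \<mu> i) \<cdot> (\<xi> i j \<otimes> Id (V i)) \<cdot> (Id (V i) \<otimes> \<xi> i j)"
      "\<xi> i j \<cdot> (Id (V i) \<otimes> \<mu> j) = (\<mu> j \<otimes> Id (V i)) \<cdot> (Id (V j) \<otimes> \<xi> i j) \<cdot> (\<xi> i j \<otimes> Id (V j))"
      by blast+
  next
    fix i j k assume ijk: "1 \<le> i" "i < j" "j < k" "k \<le> Suc n"
    show "yang_baxter (V i) (V j) (V k) (\<xi> i j) (\<xi> i k) (\<xi> j k)"
    proof (cases "k = Suc n")
      case True
      then show ?thesis using triple[of i j] ijk by simp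
    next
      case False
      then show ?thesis using c ijk unfolding compatible_def by simp
    qed
  qed
qed

section \<open>The three conditions\<close>

text \<open>With the diagonal morphisms \<open>sigma_Ass\<close>, the Yang-Baxter equations for \<open>i \<le> j \<le> k\<close> split into four kinds: all indices
  equal (true by associativity), first two equal and last two equal (naturality for \<open>\<mu> i\<close> and \<open>\<mu> j\<close>), and all
  distinct.\<close>

lemma pointed_braided_system_iff_compatible:
  "pointed_braided_system C r V (\<lambda>i j. if i = j then sigma_Ass C (\<mu> i) (\<nu> i) else \<xi> i j) \<nu> \<longleftrightarrow> compatible r"
proof -
  define s where "s = (\<lambda>i j. if i = j then sigma_Ass C (\<mu> i) (\<nu> i) else \<xi> i j)"
  define Y where "Y i j k = yang_baxter (V i) (V j) (V k) (s i j) (s i k) (s j k)" for i j k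
  have Y: "colored_YBE C V s i j k = Y i j k" for i j k
    by (simp add: Y_def colored_YBE_def yang_baxter_def)
  have s_Hom: "s i j \<in> Hom C (V i \<odot> V j) (V j \<odot> V i)" if "1 \<le> i" "i \<le> j" "j \<le> r" for i j
    using that sigma_Ass_Hom[OF objects mult_Hom unit_Hom, of i] swap_Hom[of i j]
    by (cases "i = j") (simp_all add: s_def)
  have diag: "Y i i i" if "1 \<le> i" "i \<le> r" for i
    using yang_baxter_sigma_Ass[OF objects mult_Hom unit_Hom mult_assoc mult_unit_left, of i] that
    by (simp add: Y_def s_def)
  have fst: "Y i i j \<longleftrightarrow> \<xi> i j \<cdot> (\<mu> i \<otimes> Id (V j)) = (Id (V j) \<otimes> \<mu> i) \<cdot> (\<xi> i j \<otimes> Id (V i)) \<cdot> (Id (V i) \<otimes> \<xi> i j)"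
    and snd: "Y i j j \<longleftrightarrow> \<xi> i j \<cdot> (Id (V i) \<otimes> \<mu> j) = (\<mu> j \<otimes> Id (V i)) \<cdot> (Id (V j) \<otimes> \<xi> i j) \<cdot> (\<xi> i j \<otimes> Id (V j))"
    if ij: "1 \<le> i" "i < j" "j \<le> r" for i j
  proof -
    have b: "i \<le> r" "1 \<le> j" using ij by auto
    obtain e e' where e: "e \<in> Hom C (V i) \<I>" "e \<cdot> \<nu> i = Id \<I>" and e': "e' \<in> Hom C (V j) \<I>" "e' \<cdot> \<nu> j = Id \<I>"
      using split_unit[OF ij(1) b(1)] split_unit[OF b(2) ij(3)] by auto
    note o = objects[OF ij(1) b(1)] objects[OF b(2) ij(3)] swap_Hom[OF ij]
    show "Y i i j \<longleftrightarrow> \<xi> i j \<cdot> (\<mu> i \<otimes> Id (V j)) = (Id (V j) \<otimes> \<mu> i) \<cdot> (\<xi> i j \<otimes> Id (V i)) \<cdot> (Id (V i) \<otimes> \<xi> i j)"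
      using yang_baxter_sigma_Ass_fst_iff[OF o mult_Hom[OF ij(1) b(1)] unit_Hom[OF ij(1) b(1)] e swap_unit_fst[OF ij]] ij(2)
      by (simp add: Y_def s_def)
    show "Y i j j \<longleftrightarrow> \<xi> i j \<cdot> (Id (V i) \<otimes> \<mu> j) = (\<mu> j \<otimes> Id (V i)) \<cdot> (Id (V j) \<otimes> \<xi> i j) \<cdot> (\<xi> i j \<otimes> Id (V j))"
      using yang_baxter_sigma_Ass_snd_iff[OF o mult_Hom[OF b(2) ij(3)] unit_Hom[OF b(2) ij(3)] e' swap_unit_snd[OF ij]] ij(2)
      by (simp add: Y_def s_def)
  qed
  have "(\<forall>i j k. 1 \<le> i \<and> i \<le> j \<and> j \<le> k \<and> k \<le> r \<longrightarrow> Y i j k) \<longleftrightarrow>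
    (\<forall>i j. 1 \<le> i \<and> i < j \<and> j \<le> r \<longrightarrow> Y i i j \<and> Y i j j) \<and> (\<forall>i j k. 1 \<le> i \<and> i < j \<and> j < k \<and> k \<le> r \<longrightarrow> Y i j k)"
    using diag by (auto simp: le_less)
  also have "\<dots> \<longleftrightarrow> compatible r"
    unfolding compatible_def using fst snd by (auto simp: Y_def s_def)
  finally show ?thesis
    unfolding pointed_braided_system_def braided_system_def s_def[symmetric] Y
    using objects unit_Hom s_Hom by blast
qed

end

theorem theorem4p5:
  fixes C :: "('o, 'm, 'z) smc_scheme" and r :: nat
    and V :: "nat \<Rightarrow> 'o" and \<mu> \<nu> :: "nat \<Rightarrow> 'm" and \<xi> :: "nat \<Rightarrow> nat \<Rightarrow> 'm"
  assumes "strict_monoidal_category C"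
    and "\<forall>i. 1 \<le> i \<and> i \<le> r \<longrightarrow> unital_assoc_algebra C (V i) (\<mu> i) (\<nu> i)"
    and "\<forall>i j. 1 \<le> i \<and> i < j \<and> j \<le> r \<longrightarrow> \<xi> i j \<in> Hom C (V i \<odot>\<^bsub>C\<^esub> V j) (V j \<odot>\<^bsub>C\<^esub> V i)"
    and "\<forall>i j. 1 \<le> i \<and> i < j \<and> j \<le> r \<longrightarrow>
           natural_fst C (V i) (V j) (\<xi> i j) 0 1 (\<nu> i) \<and>
           natural_snd C (V i) (V j) (\<xi> i j) 0 1 (\<nu> j)"
    and "\<forall>i. 1 \<le> i \<and> i \<le> r \<longrightarrow> (\<exists>\<epsilon>. normalized_pair C (V i) (\<nu> i) \<epsilon>)"
  defines "cond_A \<equiv> pointed_braided_system C r V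
                 (\<lambda>i j. if i = j then sigma_Ass C (\<mu> i) (\<nu> i) else \<xi> i j) \<nu>"
    and "cond_B \<equiv> (\<forall>i j. 1 \<le> i \<and> i < j \<and> j \<le> r \<longrightarrow>
                 natural_fst C (V i) (V j) (\<xi> i j) 2 1 (\<mu> i) \<and>
                 natural_snd C (V i) (V j) (\<xi> i j) 2 1 (\<mu> j)) \<and>
              (\<forall>i j k. 1 \<le> i \<and> i < j \<and> j < k \<and> k \<le> r \<longrightarrow> colored_YBE C V \<xi> i j k)"
    and "cond_C \<equiv> unital_assoc_algebra C (rev_obj C r V) (rev_mult C r V \<mu> \<xi>) (rev_unit C r \<nu>)"
  shows "(cond_A \<longleftrightarrow> cond_B) \<and> (cond_B \<longleftrightarrow> cond_C)"
proof -
  interpret strict_monoidal_category C by (rule assms(1))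
  have objs: "V i \<in> Obj C" "\<nu> i \<in> Hom C (Unit C) (V i)" if "1 \<le> i" "i \<le> r" for i
    using assms(2) that by (auto simp: unital_assoc_algebra_def)
  have swap: "\<xi> i j \<in> Hom C (V i \<odot>\<^bsub>C\<^esub> V j) (V j \<odot>\<^bsub>C\<^esub> V i)" if "1 \<le> i" "i < j" "j \<le> r" for i j
    using assms(3) that by blast
  interpret split_algebra_family C r V \<mu> \<nu> \<xi>
  proof unfold_locales
    fix i j assume ij: "1 \<le> i" "i < j" "j \<le> r"
    then have b: "i \<le> r" "1 \<le> j" by auto
    note o = objs(1)[OF ij(1) b(1)] objs(1)[OF b(2) ij(3)] swap[OF ij]
    have n: "natural_fst C (V i) (V j) (\<xi> i j) 0 1 (\<nu> i)" "natural_snd C (V i) (V j) (\<xi> i j) 0 1 (\<nu> j)"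
      using assms(4) ij by blast+
    show "\<xi> i j \<cdot>\<^bsub>C\<^esub> (\<nu> i \<otimes>\<^bsub>C\<^esub> Idt C (V j)) = Idt C (V j) \<otimes>\<^bsub>C\<^esub> \<nu> i"
      using natural_unit_iff(1)[OF o objs(2)[OF ij(1) b(1)]] n by simp
    show "\<xi> i j \<cdot>\<^bsub>C\<^esub> (Idt C (V i) \<otimes>\<^bsub>C\<^esub> \<nu> j) = \<nu> j \<otimes>\<^bsub>C\<^esub> Idt C (V i)"
      using natural_unit_iff(2)[OF o objs(2)[OF b(2) ij(3)]] n by simp
  next
    fix i assume "1 \<le> i" "i \<le> r"
    then show "\<exists>e \<in> Hom C (V i) (Unit C). e \<cdot>\<^bsub>C\<^esub> \<nu> i = Idt C (Unit C)"
      using assms(5) unfolding normalized_pair_def by blast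
  qed (use assms(2,3) in auto)
  have A: "cond_A \<longleftrightarrow> compatible r"
    unfolding cond_A_def by (rule pointed_braided_system_iff_compatible)
  have nat: "natural_fst C (V i) (V j) (\<xi> i j) 2 1 (\<mu> i) \<longleftrightarrow>
       \<xi> i j \<cdot>\<^bsub>C\<^esub> (\<mu> i \<otimes>\<^bsub>C\<^esub> Idt C (V j)) = (Idt C (V j) \<otimes>\<^bsub>C\<^esub> \<mu> i) \<cdot>\<^bsub>C\<^esub> (\<xi> i j \<otimes>\<^bsub>C\<^esub> Idt C (V i)) \<cdot>\<^bsub>C\<^esub> (Idt C (V i) \<otimes>\<^bsub>C\<^esub> \<xi> i j)"
     "natural_snd C (V i) (V j) (\<xi> i j) 2 1 (\<mu> j) \<longleftrightarrow>
       \<xi> i j \<cdot>\<^bsub>C\<^esub> (Idt C (V i) \<otimes>\<^bsub>C\<^esub> \<mu> j) = (\<mu> j \<otimes>\<^bsub>C\<^esub> Idt C (V i)) \<cdot>\<^bsub>C\<^esub> (Idt C (V j) \<otimes>\<^bsub>C\<^esub> \<xi> i j) \<cdot>\<^bsub>C\<^esub> (\<xi> i j \<otimes>\<^bsub>C\<^esub> Idt C (V j))"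
    if "1 \<le> i" "i < j" "j \<le> r" for i j
    using natural_mult_iff[OF objs(1) objs(1) swap[OF that]] that by simp_all
  have "colored_YBE C V \<xi> i j k \<longleftrightarrow> yang_baxter (V i) (V j) (V k) (\<xi> i j) (\<xi> i k) (\<xi> j k)" for i j k
    by (simp add: colored_YBE_def yang_baxter_def)
  then have B: "cond_B \<longleftrightarrow> compatible r"
    unfolding cond_B_def compatible_def using nat by auto
  have "cond_C \<longleftrightarrow> associative r"
    unfolding cond_C_def unital_assoc_algebra_def associative_def
    using rev_obj_Obj[of r] rev_mult_Hom[of r] rev_unit_Hom[of r] rev_mult_units[of r] by auto
  then have C: "cond_C \<longleftrightarrow> compatible r"
    using compatible_imp_associative[of r] associative_imp_compatible[of r] by auto
  show ?thesis using A B C by simp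
qed

end
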